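(* Let $J_0$ be a two-sided $p$-periodic Jacobi matrix and let $J$ be a one-sided Jacobi matrix with bounded Jacobi parameters all of whose right limits lie in $\mathcal{T}_{J_0}$. Let $\mu$ be the spectral measure of $J$ and $\{p_n\}_{n\ge0}$ its orthonormal polynomials. Then (a) $\frac1p\sum_{j=1}^p|p_{j+n}(x)|^2\,d\mu(x)\to d\nu$ weakly as $n\to\infty$; (b) the zero counting measures of $p_n$ (assigning weight $1/n$ to each zero of $p_n$) converge weakly to $\nu$.
   Context: A one-sided Jacobi matrix $J$ acts on $\ell^2(\{1,2,\dots\})$ with $J_{nn}=b_n\in\mathbb{R}$, $J_{n,n+1}=J_{n+1,n}=a_n>0$; $\mu$ satisfies $\langle\delta_1,f(J)\delta_1\rangle=\int f\,d\mu$, and $p_n$ are the orthonormal polynomials in $L^2(\mu)$ with positive leading coefficients, $p_0=1$. A right limit of $J$ is a two-sided sequence $\{(a^r_k,b^r_k)\}_{k\in\mathbb{Z}}$ (some $a^r_k$ possibly $0$) such that for some $n_j\to\infty$, $a_{n_j+k}\to a^r_k$ and $b_{n_j+k}\to b^r_k$ for every $k\in\mathbb{Z}$. For the $p$-periodic two-sided Jacobi matrix $J_0$ with parameters $a^{(0)}_n,b^{(0)}_n$, the discriminant is $\Delta(x)=\mathrm{Tr}(\Lambda_p(x)\cdots\Lambda_1(x))$, $\Lambda_n(x)=\frac1{a^{(0)}_n}\begin{pmatrix}x-b^{(0)}_n&-1\\(a^{(0)}_n)^2&0\end{pmatrix}$; $\sigma(J_0)=\Delta^{-1}([-2,2])$;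 $\mathcal{T}_{J_0}$ is the set of two-sided $p$-periodic Jacobi parameter sequences with discriminant $\Delta$. $\nu$ is the density of states (harmonic measure) of $\sigma(J_0)$: $d\nu(x)=\frac{2}{p}\frac{|\Delta'(x)|}{\sqrt{4-\Delta(x)^2}}\frac{dx}{2\pi}$ on $\sigma(J_0)$. *)

theory Defs
  imports "HOL-Probability.Probability" "HOL-Computational_Algebra.Polynomial"
begin

definition jac_entry :: "(nat \<Rightarrow> real) \<Rightarrow> (nat \<Rightarrow> real) \<Rightarrow> nat \<Rightarrow> nat \<Rightarrow> real" where
  "jac_entry a b i j =
     (if i = 0 \<or> j = 0 then 0
      else if i = j then b i
      else if j = i + 1 then a i
      else if i = j + 1 then a j
      else 0)"

text \<open>Entries of the powers J^k (each is a finite sum since J is banded).\<close>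
fun jac_pow :: "(nat \<Rightarrow> real) \<Rightarrow> (nat \<Rightarrow> real) \<Rightarrow> nat \<Rightarrow> nat \<Rightarrow> nat \<Rightarrow> real" where
  "jac_pow a b 0 i j = (if i = j then 1 else 0)"
| "jac_pow a b (Suc k) i j = (\<Sum>l\<in>{1..j+1}. jac_pow a b k i l * jac_entry a b l j)"

text \<open>mu is the spectral measure of J (w.r.t. delta_1): <delta_1, f(J) delta_1> = int f dmu for
  polynomial f; for bounded J this determines mu uniquely.\<close>
definition is_spectral_measure :: "(nat \<Rightarrow> real) \<Rightarrow> (nat \<Rightarrow> real) \<Rightarrow> real measure \<Rightarrow> bool" where
  "is_spectral_measure a b \<mu> \<longleftrightarrow>
     sets \<mu> = sets borel \<and> finite_measure \<mu> \<and>
     (\<forall>k. integrable \<mu> (\<lambda>x. x ^ k) \<and> (\<integral>x. x ^ k \<partial>\<mu>) = jac_pow a b k 1 1)"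

definition is_orthonormal_polys :: "real measure \<Rightarrow> (nat \<Rightarrow> real poly) \<Rightarrow> bool" where
  "is_orthonormal_polys \<mu> P \<longleftrightarrow>
     (\<forall>n. degree (P n) = n \<and> lead_coeff (P n) > 0) \<and>
     (\<forall>n m. (\<integral>x. poly (P n) x * poly (P m) x \<partial>\<mu>) = (if n = m then 1 else 0))"

type_synonym mat2 = "real \<times> real \<times> real \<times> real"

definition mat2_mult :: "mat2 \<Rightarrow> mat2 \<Rightarrow> mat2" where
  "mat2_mult A B = (case A of (a11, a12, a21, a22) \<Rightarrow> case B of (b11, b12, b21, b22) \<Rightarrow>
     (a11*b11 + a12*b21, a11*b12 + a12*b22, a21*b11 + a22*b21, a21*b12 + a22*b22))"

definition mat2_trace :: "mat2 \<Rightarrow> real" where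
  "mat2_trace A = (case A of (a11, a12, a21, a22) \<Rightarrow> a11 + a22)"

text \<open>Lambda_n(x) = (1/a_n) [[x - b_n, -1], [a_n^2, 0]].\<close>
definition transfer_step :: "(int \<Rightarrow> real) \<Rightarrow> (int \<Rightarrow> real) \<Rightarrow> int \<Rightarrow> real \<Rightarrow> mat2" where
  "transfer_step a b n x = ((x - b n) / a n, -1 / a n, (a n)\<^sup>2 / a n, 0)"

fun transfer :: "(int \<Rightarrow> real) \<Rightarrow> (int \<Rightarrow> real) \<Rightarrow> nat \<Rightarrow> real \<Rightarrow> mat2" where
  "transfer a b 0 x = (1, 0, 0, 1)"
| "transfer a b (Suc n) x = mat2_mult (transfer_step a b (int (Suc n)) x) (transfer a b n x)"

definition discriminant :: "(int \<Rightarrow> real) \<Rightarrow> (int \<Rightarrow> real) \<Rightarrow> nat \<Rightarrow> real \<Rightarrow> real" where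
  "discriminant a b p x = mat2_trace (transfer a b p x)"

definition periodic_jacobi :: "nat \<Rightarrow> (int \<Rightarrow> real) \<Rightarrow> (int \<Rightarrow> real) \<Rightarrow> bool" where
  "periodic_jacobi p a b \<longleftrightarrow> p \<ge> 1 \<and> (\<forall>n. a n > 0) \<and>
     (\<forall>n. a (n + int p) = a n \<and> b (n + int p) = b n)"

definition iso_torus :: "nat \<Rightarrow> (int \<Rightarrow> real) \<Rightarrow> (int \<Rightarrow> real) \<Rightarrow> ((int \<Rightarrow> real) \<times> (int \<Rightarrow> real)) set" where
  "iso_torus p a0 b0 = {(a, b). periodic_jacobi p a b \<and> discriminant a b p = discriminant a0 b0 p}"

definition periodic_spectrum :: "nat \<Rightarrow> (int \<Rightarrow> real) \<Rightarrow> (int \<Rightarrow> real) \<Rightarrow> real set" where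
  "periodic_spectrum p a0 b0 = {x. \<bar>discriminant a0 b0 p x\<bar> \<le> 2}"

definition dos_measure :: "nat \<Rightarrow> (int \<Rightarrow> real) \<Rightarrow> (int \<Rightarrow> real) \<Rightarrow> real measure" where
  "dos_measure p a0 b0 = density lborel (\<lambda>x. ennreal (indicator (periodic_spectrum p a0 b0) x *
      ((2 / real p) * \<bar>deriv (discriminant a0 b0 p) x\<bar> / sqrt (4 - (discriminant a0 b0 p x)\<^sup>2)
        / (2 * pi))))"

text \<open>(ar, br) is a right limit of the one-sided parameters (a, b): along some n_j \<rightarrow> \<infinity>,
  a(n_j + k) \<rightarrow> ar k and b(n_j + k) \<rightarrow> br k for every integer k (n_j + k \<ge> 1 eventually).\<close>
definition is_right_limit :: "(nat \<Rightarrow> real) \<Rightarrow> (nat \<Rightarrow> real) \<Rightarrow> (int \<Rightarrow> real) \<Rightarrow> (int \<Rightarrow> real) \<Rightarrow> bool" where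
  "is_right_limit a b ar br \<longleftrightarrow>
     (\<exists>n :: nat \<Rightarrow> nat. filterlim n at_top sequentially \<and>
        (\<forall>k :: int. (\<lambda>j. a (nat (int (n j) + k))) \<longlonglongrightarrow> ar k \<and>
                    (\<lambda>j. b (nat (int (n j) + k))) \<longlonglongrightarrow> br k))"

definition bounded_continuous_test :: "(real \<Rightarrow> real) \<Rightarrow> bool" where
  "bounded_continuous_test f \<longleftrightarrow> continuous_on UNIV f \<and> bounded (range f)"

end

theory Submission
  imports Defs "HOL-Computational_Algebra.Fundamental_Theorem_Algebra"
begin

text \<open>Both limits are checked on moments. The diagonal entries of J^l are polynomials in nearby Jacobi
  parameters, so by compactness their averages over a period converge to the corresponding averages
  along right limits, that is, for periodic matrices with discriminant \<open>\<Delta>\<close>. The power sums of the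
  zeros of p_n differ from the sum of the first n diagonal entries by a bounded amount (Gauss
  quadrature).

  For a periodic matrix the average is identified by applying this comparison to the matrix itself:
  its orthogonal polynomial of degree N p - 1 is a fixed factor times the Chebyshev polynomial
  \<open>U (N - 1)\<close> at \<open>\<Delta> / 2\<close>. All its zeros are real and simple, which forces every fibre
  \<open>\<Delta> = 2 cos (\<pi> k / N)\<close> to have p real points. Hence \<open>\<Delta>\<close> maps each interval between consecutive
  critical points injectively onto a set containing (-2, 2), and the power sums of the zeros are
  Riemann sums, in the variable \<open>arccos (\<Delta> / 2) / \<pi>\<close>, for the integral against the density of
  states.\<close>

section \<open>Powers of a two-sided Jacobi matrix\<close>

text \<open>Right limits change along the sequence and share only \<open>\<Delta>\<close>, so the
  averaged diagonal has to be expressed through \<open>\<Delta>\<close> alone. Zeros do this: the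
  Chebyshev factor (Cayley-Hamilton for a monodromy matrix of determinant one) sees the matrix only
  through \<open>\<Delta>\<close>, and the p - 1 further zeros have no weight in the mean. The
  obstacle is to get the band structure of \<open>\<Delta>\<close> from counting. Full fibres are
  known only at angles \<pi> k / N, and such a value could be critical, so that a fibre point would
  sit between two bands. Angles of this form avoiding the finitely many critical values are dense; a
  pigeonhole count at one of them yields exactly p - 1 distinct real critical points, and
  connectedness of the bands carries surjectivity to all remaining angles. Moments suffice because
  everything lives on one compact interval: zeros are eigenvalues of truncations with bounded row
  sums, \<mu> is confined by the growth of its even moments, and the spectrum is bounded because
  \<open>\<Delta>\<close> is a nonconstant polynomial.\<close>

text \<open>The (i,j) entry of J^l as a sum over l-step lattice walks. A factor J is peeled off on
  the left, so the column stays fixed and the recursion is that of generalised eigenvectors.\<close>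

fun walk :: "(int \<Rightarrow> real) \<Rightarrow> (int \<Rightarrow> real) \<Rightarrow> nat \<Rightarrow> int \<Rightarrow> int \<Rightarrow> real" where
  "walk a b 0 i j = (if i = j then 1 else 0)"
| "walk a b (Suc l) i j =
     a i * walk a b l (i + 1) j + b i * walk a b l i j + a (i - 1) * walk a b l (i - 1) j"

text \<open>\<open>2 * A + B\<close> bounds the absolute row sums of J.\<close>

lemma walk_bound:
  assumes "\<And>k. \<bar>a k\<bar> \<le> A" "\<And>k. \<bar>b k\<bar> \<le> B"
  shows "\<bar>walk a b l i j\<bar> \<le> (2 * A + B) ^ l"
proof (induction l arbitrary: i)
  case 0
  then show ?case by auto
next
  case (Suc l)
  have A0: "A \<ge> 0" and B0: "B \<ge> 0" using assms[of 0] by linarith+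
  let ?C = "(2 * A + B) ^ l"
  have "\<bar>walk a b (Suc l) i j\<bar> \<le> \<bar>a i * walk a b l (i + 1) j\<bar> + \<bar>b i * walk a b l i j\<bar>
      + \<bar>a (i - 1) * walk a b l (i - 1) j\<bar>"
    by simp
  also have "\<dots> \<le> A * ?C + B * ?C + A * ?C"
    unfolding abs_mult using Suc assms A0 B0 by (intro add_mono mult_mono) auto
  finally show ?case by (simp add: algebra_simps)
qed

lemma walk_shift:
  "walk (\<lambda>k. a (k + s)) (\<lambda>k. b (k + s)) l i j = walk a b l (i + s) (j + s)"
proof (induction l arbitrary: i)
  case (Suc l)
  have e: "i + 1 + s = i + s + 1" "i - 1 + s = i + s - 1" by simp_all
  show ?case unfolding walk.simps Suc e ..
qed simp

text \<open>An l-step walk from i never goes below i - l. The condition is one-sided because a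
  periodic matrix and its cut to the half-line differ only at sites below 1.\<close>

lemma walk_cong:
  assumes "\<And>k. i - int l \<le> k \<Longrightarrow> a k = a' k \<and> b k = b' k"
  shows "walk a b l i j = walk a' b' l i j"
  using assms
proof (induction l arbitrary: i)
  case (Suc l)
  have "walk a b l (i + 1) j = walk a' b' l (i + 1) j" "walk a b l i j = walk a' b' l i j"
    "walk a b l (i - 1) j = walk a' b' l (i - 1) j"
    by (rule Suc.IH; use Suc.prems in auto)+
  moreover have "a i = a' i \<and> b i = b' i" "a (i - 1) = a' (i - 1)"
    using Suc.prems[of i] Suc.prems[of "i - 1"] by auto
  ultimately show ?case by simp
qed simp

lemma walk_tendsto:
  assumes "\<And>k. ((\<lambda>n. a n k) \<longlongrightarrow> a' k) F" "\<And>k. ((\<lambda>n. b n k) \<longlongrightarrow> b' k) F"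
  shows "((\<lambda>n. walk (a n) (b n) l i j) \<longlongrightarrow> walk a' b' l i j) F"
proof (induction l arbitrary: i)
  case (Suc l)
  then show ?case unfolding walk.simps by (intro tendsto_intros assms)
qed simp

text \<open>Extending by zero cuts the bond between sites 0 and 1, so a one-sided matrix is treated
  as the two-sided one that is the direct sum with zero.\<close>

definition zext :: "(nat \<Rightarrow> real) \<Rightarrow> int \<Rightarrow> real" where
  "zext a k = (if k \<ge> 1 then a (nat k) else 0)"

lemma zext_of_nat [simp]: "n \<ge> 1 \<Longrightarrow> zext a (int n) = a n"
  by (simp add: zext_def)

lemma abs_zext_le:
  assumes "\<And>n. n \<ge> 1 \<Longrightarrow> \<bar>a n\<bar> \<le> A"
  shows "\<bar>zext a k\<bar> \<le> A"
  using assms[of "nat k"] assms[of 1] by (auto simp: zext_def)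

text \<open>Finite propagation speed: l steps from i reach rows up to i + l only, so initial values
  and recursion are required just up to row n. Applied to quadrature at the zeros and to integrals
  against \<mu>.\<close>

lemma walk_zext_unique:
  fixes G :: "nat \<Rightarrow> nat \<Rightarrow> real"
  assumes G0: "\<And>i. 1 \<le> i \<Longrightarrow> i \<le> n \<Longrightarrow> G 0 i = (if i = j then 1 else 0)"
    and bdry: "\<And>l. G l 0 = 0"
    and step: "\<And>l i. 1 \<le> i \<Longrightarrow> i \<le> n \<Longrightarrow>
        G (Suc l) i = a i * G l (Suc i) + b i * G l i + a (i - 1) * G l (i - 1)"
    and "1 \<le> i" "i + l \<le> n"
  shows "G l i = walk (zext a) (zext b) l (int i) (int j)"
  using assms(4,5)
proof (induction l arbitrary: i)
  case 0
  then show ?case using G0[of i] by simp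
next
  case (Suc l)
  have 1: "G l (Suc i) = walk (zext a) (zext b) l (int i + 1) (int j)"
    using Suc.IH[of "Suc i"] Suc.prems by (simp add: add.commute)
  have 2: "G l i = walk (zext a) (zext b) l (int i) (int j)"
    using Suc.IH[of i] Suc.prems by simp
  \<comment> \<open>At i = 1 the term with \<open>a 0\<close> dies because \<open>G l 0 = 0\<close>
    on one side and \<open>zext a 0 = 0\<close> on the other.\<close>
  have 3: "a (i - 1) * G l (i - 1) = zext a (int i - 1) * walk (zext a) (zext b) l (int i - 1) (int j)"
  proof (cases "i = 1")
    case True
    then show ?thesis by (simp add: bdry zext_def)
  next
    case False
    then have "int i - 1 = int (i - 1)" "i - 1 \<ge> 1" using Suc.prems by auto
    then show ?thesis using Suc.IH[of "i - 1"] Suc.prems zext_of_nat[of "i - 1" a] by simp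
  qed
  show ?case using step[of i l] Suc.prems 1 2 3 by simp
qed

section \<open>Orthogonal polynomials from the three-term recursion\<close>

text \<open>The index is shifted by one: \<open>orth a b (n + 1)\<close> has degree n, and the values
  \<open>poly (orth a b n) x\<close> form the generalised eigenvector of J at x. Since \<open>orth a b 0 = 0\<close>,
  the value of \<open>a 0\<close> is irrelevant.\<close>

fun orth :: "(nat \<Rightarrow> real) \<Rightarrow> (nat \<Rightarrow> real) \<Rightarrow> nat \<Rightarrow> real poly" where
  "orth a b 0 = 0"
| "orth a b (Suc 0) = 1"
| "orth a b (Suc (Suc n)) = smult (1 / a (Suc n))
     ([:- b (Suc n), 1:] * orth a b (Suc n) - smult (a n) (orth a b n))"

lemma orth_rec:
  assumes "a (Suc n) > 0"
  shows "[:0, 1:] * orth a b (Suc n) = smult (a (Suc n)) (orth a b (Suc (Suc n)))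
     + smult (b (Suc n)) (orth a b (Suc n)) + smult (a n) (orth a b n)"
proof -
  have "pCons (- b (Suc n)) 1 = [:0, 1:] - [:b (Suc n):]" by simp
  then show ?thesis using assms by (simp add: algebra_simps smult_diff_right one_pCons)
qed

lemma degree_orth:
  assumes apos: "\<And>n. n \<ge> 1 \<Longrightarrow> a n > 0"
  shows "degree (orth a b (Suc n)) = n \<and> lead_coeff (orth a b (Suc n)) > 0"
proof (induction n rule: less_induct)
  case (less n)
  show ?case
  proof (cases n)
    case 0
    then show ?thesis by simp
  next
    case (Suc m)
    let ?q = "[:- b (Suc m), 1:] * orth a b (Suc m)" and ?r = "smult (a m) (orth a b m)"
    have IH: "degree (orth a b (Suc m)) = m" "lead_coeff (orth a b (Suc m)) > 0"
      using less.IH[of m] Suc by auto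
    then have "orth a b (Suc m) \<noteq> 0" by auto
    then have q1: "degree ?q = Suc m"
      using IH by (simp add: degree_mult_eq del: mult_pCons_left)
    have "lead_coeff ?q > 0"
      unfolding lead_coeff_mult using IH by simp
    with q1 have q: "degree ?q = Suc m" "coeff ?q (Suc m) > 0" by simp_all
    have r: "degree ?r < Suc m"
    proof (cases m)
      case (Suc k)
      then show ?thesis using less.IH[of k] \<open>n = Suc m\<close> by (auto intro: le_less_trans[OF degree_smult_le])
    qed simp
    have d: "degree (?q - ?r) = Suc m"
      using degree_add_eq_left[of "- ?r" ?q] q r by (simp del: mult_pCons_left)
    moreover have "coeff (?q - ?r) (Suc m) > 0"
      unfolding coeff_diff coeff_eq_0[OF r] using q by (simp only: diff_0_right)
    ultimately show ?thesis using apos[of "Suc m"] Suc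
      by (simp del: mult_pCons_left)
  qed
qed

lemma poly_map_of_real:
  "poly (map_poly of_real p) (of_real x) = (of_real (poly p x) :: 'a::{real_algebra_1,comm_semiring_1})"
  by (induction p) (simp_all add: map_poly_pCons)

definition orth_roots :: "(nat \<Rightarrow> real) \<Rightarrow> (nat \<Rightarrow> real) \<Rightarrow> nat \<Rightarrow> real set" where
  "orth_roots a b n = {x. poly (orth a b (Suc n)) x = 0}"

locale jacobi =
  fixes a b :: "nat \<Rightarrow> real"
  assumes apos: "\<And>n. n \<ge> 1 \<Longrightarrow> a n > 0"
begin

abbreviation "u \<equiv> orth a b"

lemma u_nz [simp]: "u (Suc n) \<noteq> 0"
  using degree_orth[of a b n] apos by auto

lemma degree_u [simp]: "degree (u (Suc n)) = n"
  using degree_orth[of a b n] apos by blast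

lemma u_rec:
  "[:0, 1:] * u (Suc n) = smult (a (Suc n)) (u (Suc (Suc n)))
     + smult (b (Suc n)) (u (Suc n)) + smult (a n) (u n)"
  by (rule orth_rec) (simp add: apos)

lemma poly_u_rec:
  "x * poly (u (Suc n)) x = a (Suc n) * poly (u (Suc (Suc n))) x
     + b (Suc n) * poly (u (Suc n)) x + a n * poly (u n) x"
  using arg_cong[OF orth_rec[of a n b], of "\<lambda>p. poly p x"] apos[of "Suc n"] by simp

lemma poly_u_rec':
  assumes "1 \<le> i"
  shows "x * poly (u i) x = a i * poly (u (Suc i)) x
     + b i * poly (u i) x + a (i - 1) * poly (u (i - 1)) x"
  using poly_u_rec[of x "i - 1"] assms by simp

section \<open>Christoffel-Darboux formula and zeros\<close>

definition cu :: "nat \<Rightarrow> complex \<Rightarrow> complex" where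
  "cu n z = poly (map_poly of_real (u n)) z"

lemma cu_simps [simp]: "cu 0 z = 0" "cu (Suc 0) z = 1"
  by (simp_all add: cu_def)

lemma cu_of_real: "cu n (of_real x) = of_real (poly (u n) x)"
  unfolding cu_def by (rule poly_map_of_real)

lemma cu_rec:
  "z * cu (Suc n) z = a (Suc n) * cu (Suc (Suc n)) z + b (Suc n) * cu (Suc n) z + a n * cu n z"
proof -
  have h: "map_poly complex_of_real (p * q) = map_poly of_real p * map_poly of_real q"
    "map_poly complex_of_real (p + q) = map_poly of_real p + map_poly of_real q"
    "map_poly complex_of_real (smult c q) = smult (of_real c) (map_poly of_real q)" for p q c
    by (auto simp: poly_eq_iff coeff_map_poly coeff_mult)
  have "map_poly complex_of_real ([:0, 1:] * u (Suc n)) = map_poly of_real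
     (smult (a (Suc n)) (u (Suc (Suc n))) + smult (b (Suc n)) (u (Suc n)) + smult (a n) (u n))"
    by (subst orth_rec) (simp_all add: apos)
  from arg_cong[OF this, of "\<lambda>p. poly p z"] show ?thesis
    unfolding h cu_def by (simp add: map_poly_pCons)
qed

text \<open>Applying the recursion at z and at w, the \<open>b\<close> terms cancel and one new
  summand remains. The choice w = cnj z gives real zeros; two distinct real zeros give the
  orthogonality behind quadrature.\<close>

lemma christoffel_darboux:
  "(z - w) * (\<Sum>i=1..n. cu i z * cu i w)
     = a n * (cu (Suc n) z * cu n w - cu n z * cu (Suc n) w)"
proof (induction n)
  case (Suc n)
  have rz: "a (Suc n) * cu (Suc (Suc n)) x = x * cu (Suc n) x - b (Suc n) * cu (Suc n) x - a n * cu n x" for x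
    using cu_rec[of x n] by (simp add: algebra_simps)
  have "a (Suc n) * (cu (Suc (Suc n)) z * cu (Suc n) w - cu (Suc n) z * cu (Suc (Suc n)) w)
     = (a (Suc n) * cu (Suc (Suc n)) z) * cu (Suc n) w - cu (Suc n) z * (a (Suc n) * cu (Suc (Suc n)) w)"
    by (simp add: algebra_simps)
  also have "\<dots> = (z * cu (Suc n) z - b (Suc n) * cu (Suc n) z - a n * cu n z) * cu (Suc n) w
       - cu (Suc n) z * (w * cu (Suc n) w - b (Suc n) * cu (Suc n) w - a n * cu n w)"
    unfolding rz ..
  also have "\<dots> = (z - w) * (cu (Suc n) z * cu (Suc n) w)
       + a n * (cu (Suc n) z * cu n w - cu n z * cu (Suc n) w)"
    by (simp add: algebra_simps)
  also have "\<dots> = (z - w) * (\<Sum>i=1..Suc n. cu i z * cu i w)"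
    unfolding Suc[symmetric] by (simp add: distrib_left add.commute)
  finally show ?case ..
qed simp

text \<open>The limit w -> z of the previous formula, obtained by the same induction from the
  differentiated recursion.\<close>

lemma christoffel_darboux_confluent:
  "(\<Sum>i=1..n. (poly (u i) x)\<^sup>2) = a n * (poly (pderiv (u (Suc n))) x * poly (u n) x
       - poly (pderiv (u n)) x * poly (u (Suc n)) x)"
proof (induction n)
  case (Suc n)
  have d: "poly (u (Suc n)) x + x * poly (pderiv (u (Suc n))) x
     = a (Suc n) * poly (pderiv (u (Suc (Suc n)))) x
       + b (Suc n) * poly (pderiv (u (Suc n))) x + a n * poly (pderiv (u n)) x"
    using arg_cong[OF orth_rec[of a n b, OF apos], of "\<lambda>p. poly (pderiv p) x"]
    by (simp add: pderiv_add pderiv_smult pderiv_pCons del: orth.simps)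
  have "a (Suc n) * (poly (pderiv (u (Suc (Suc n)))) x * poly (u (Suc n)) x
       - poly (pderiv (u (Suc n))) x * poly (u (Suc (Suc n))) x)
     = (a (Suc n) * poly (pderiv (u (Suc (Suc n)))) x) * poly (u (Suc n)) x
       - poly (pderiv (u (Suc n))) x * (a (Suc n) * poly (u (Suc (Suc n))) x)"
    by (simp only: algebra_simps)
  also have "a (Suc n) * poly (pderiv (u (Suc (Suc n)))) x = poly (u (Suc n)) x + x * poly (pderiv (u (Suc n))) x
     - b (Suc n) * poly (pderiv (u (Suc n))) x - a n * poly (pderiv (u n)) x"
    using d by linarith
  also have "a (Suc n) * poly (u (Suc (Suc n))) x = x * poly (u (Suc n)) x - b (Suc n) * poly (u (Suc n)) x - a n * poly (u n) x"
    using poly_u_rec[of x n] by linarith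
  finally show ?case using Suc by (simp add: algebra_simps power2_eq_square del: orth.simps)
qed simp

lemma sum_u_sq_pos:
  assumes "n \<ge> 1" shows "(\<Sum>i=1..n. (poly (u i) x)\<^sup>2) > 0"
proof -
  have "(\<Sum>i\<in>{1}. (poly (u i) x)\<^sup>2) \<le> (\<Sum>i=1..n. (poly (u i) x)\<^sup>2)"
    using assms by (intro sum_mono2) auto
  then show ?thesis by simp
qed

text \<open>With w = cnj z the right side of \<open>christoffel_darboux\<close> vanishes, while the
  sum becomes a sum of squared moduli that contains the term 1 for index 1.\<close>

lemma cu_root_real:
  assumes z: "cu (Suc n) z = 0" shows "z \<in> \<real>"
proof (cases "n = 0")
  case True
  then show ?thesis using z by simp
next
  case False
  have c: "cnj (cu i z) = cu i (cnj z)" for i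
    unfolding cu_def by (subst poly_cnj) (simp add: map_poly_map_poly o_def)
  have "(z - cnj z) * (\<Sum>i=1..n. cu i z * cnj (cu i z)) = 0"
    using christoffel_darboux[of z "cnj z" n] z c[of "Suc n"] by (simp add: c)
  also have "(\<Sum>i=1..n. cu i z * cnj (cu i z)) = of_real (\<Sum>i=1..n. (cmod (cu i z))\<^sup>2)"
    by (simp only: complex_norm_square of_real_sum)
  finally have "z - cnj z = 0 \<or> (\<Sum>i=1..n. (cmod (cu i z))\<^sup>2) = 0"
    by (simp only: mult_eq_0_iff of_real_eq_0_iff)
  moreover have "(\<Sum>i\<in>{1}. (cmod (cu i z))\<^sup>2) \<le> (\<Sum>i=1..n. (cmod (cu i z))\<^sup>2)"
    using False by (intro sum_mono2) auto
  ultimately have "z = cnj z" by simp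
  then show ?thesis by (simp add: Reals_cnj_iff)
qed

text \<open>At a zero the positive left side of the confluent formula equals a product with the
  derivative as a factor.\<close>

lemma u_roots_simple:
  assumes "poly (u (Suc n)) x = 0" shows "poly (pderiv (u (Suc n))) x \<noteq> 0"
proof (cases "n = 0")
  case False
  then show ?thesis using christoffel_darboux_confluent[of x n] sum_u_sq_pos[of n x] assms by auto
qed (use assms in simp)

lemma finite_orth_roots [simp]: "finite (orth_roots a b n)"
  unfolding orth_roots_def by (rule poly_roots_finite) simp

text \<open>A squarefree complex polynomial has as many zeros as its degree, and here all of them
  are real.\<close>

lemma card_orth_roots: "card (orth_roots a b n) = n"
proof -
  let ?p = "map_poly complex_of_real (u (Suc n))"
  have nz: "?p \<noteq> 0" by (simp add: map_poly_eq_0_iff)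
  have dg: "degree ?p = n" by (simp add: degree_map_poly)
  have pd: "pderiv ?p = map_poly of_real (pderiv (u (Suc n)))"
    by (auto simp: poly_eq_iff coeff_map_poly coeff_pderiv)
  have sq: "rsquarefree ?p"
    unfolding rsquarefree_roots
  proof (intro allI notI)
    fix z assume z: "poly ?p z = 0 \<and> poly (pderiv ?p) z = 0"
    then have "z \<in> \<real>" using cu_root_real[of n z] by (simp add: cu_def)
    then obtain x where "z = of_real x" by (auto elim: Reals_cases)
    then show False using z u_roots_simple[of n x] by (simp add: pd poly_map_of_real)
  qed
  have "card {z. poly ?p z = 0} = n"
  proof -
    have "degree ?p = degree (smult (lead_coeff ?p) (\<Prod>z | poly ?p z = 0. [:- z, 1:]))"
      by (subst complex_poly_decompose_rsquarefree[OF sq]) simp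
    also have "\<dots> = card {z. poly ?p z = 0}"
      using nz by (simp add: degree_prod_eq_sum_degree)
    finally show ?thesis using dg by simp
  qed
  moreover have "{z. poly ?p z = 0} = of_real ` orth_roots a b n"
  proof (intro equalityI subsetI)
    fix z assume z: "z \<in> {z. poly ?p z = 0}"
    then have "z \<in> \<real>" using cu_root_real[of n z] by (simp add: cu_def)
    then obtain x where "z = of_real x" by (auto elim: Reals_cases)
    then show "z \<in> of_real ` orth_roots a b n" using z by (auto simp: orth_roots_def poly_map_of_real)
  qed (auto simp: orth_roots_def poly_map_of_real)
  ultimately show ?thesis by (simp add: card_image inj_on_def)
qed

text \<open>At a zero, the values \<open>u 1\<close> to \<open>u n\<close> form an eigenvector of
  the n by n truncation; the eigenvalue equation at an entry of largest modulus bounds x by a row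
  sum.\<close>

lemma orth_roots_bound:
  assumes x: "x \<in> orth_roots a b n" and A: "\<And>k. k \<ge> 1 \<Longrightarrow> \<bar>a k\<bar> \<le> A"
    and B: "\<And>k. k \<ge> 1 \<Longrightarrow> \<bar>b k\<bar> \<le> B"
  shows "\<bar>x\<bar> \<le> 2 * A + B"
proof -
  have n: "n \<ge> 1" using x by (cases n) (auto simp: orth_roots_def)
  \<comment> \<open>Indices 0 and n + 1 are included so that both neighbours are bounded by m. Both
    entries are 0, and \<open>u 1 = 1\<close> keeps the maximum away from them.\<close>
  define m where "m = Max ((\<lambda>i. \<bar>poly (u i) x\<bar>) ` {0..Suc n})"
  have m: "\<bar>poly (u i) x\<bar> \<le> m" if "i \<le> Suc n" for i
    unfolding m_def using that by (intro Max_ge) auto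
  have "m \<in> (\<lambda>i. \<bar>poly (u i) x\<bar>) ` {0..Suc n}"
    unfolding m_def by (intro Max_in) auto
  then obtain i where i: "i \<le> Suc n" "m = \<bar>poly (u i) x\<bar>" by auto
  have m1: "m \<ge> 1" using m[of 1] by simp
  have "i \<noteq> 0" "i \<noteq> Suc n" using i m1 x by (auto simp: orth_roots_def intro!: gr0I)
  then have i1: "1 \<le> i" "i \<le> n" using i by auto
  have A0: "A \<ge> 0" "B \<ge> 0" using A[of 1] B[of 1] by auto
  have "\<bar>a (i - 1) * poly (u (i - 1)) x\<bar> \<le> A * m"
  proof (cases "i = 1")
    case True
    then show ?thesis using A0 m1 by simp
  next
    case False
    then show ?thesis unfolding abs_mult using A[of "i - 1"] m[of "i - 1"] i1 A0 m1
      by (intro mult_mono) auto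
  qed
  moreover have "\<bar>a i * poly (u (Suc i)) x\<bar> \<le> A * m" "\<bar>b i * poly (u i) x\<bar> \<le> B * m"
    unfolding abs_mult using A[of i] B[of i] m[of i] m[of "Suc i"] i1 A0 m1
    by (intro mult_mono; auto)+
  ultimately have "\<bar>x * poly (u i) x\<bar> \<le> A * m + B * m + A * m"
    unfolding poly_u_rec'[OF i1(1)] by linarith
  then have "\<bar>x\<bar> * m \<le> (2 * A + B) * m" using i by (simp add: abs_mult algebra_simps)
  then show ?thesis using m1 by simp
qed

section \<open>Gauss quadrature and traces of truncations\<close>

lemma orth_indep:
  assumes "(\<Sum>i=1..n. smult (c i) (u i)) = 0" "1 \<le> i" "i \<le> n"
  shows "c i = 0"
  using assms
proof (induction n)
  case (Suc n)
  have low: "coeff (\<Sum>i=1..n. smult (c i) (u i)) n = 0"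
  proof -
    have "coeff (u i) n = 0" if "i \<in> {1..n}" for i
      using that degree_u[of "i - 1"] by (intro coeff_eq_0) auto
    then show ?thesis by (simp add: coeff_sum)
  qed
  have "coeff (\<Sum>i=1..Suc n. smult (c i) (u i)) n = c (Suc n) * lead_coeff (u (Suc n))"
    using low by (simp del: orth.simps)
  moreover have "lead_coeff (u (Suc n)) > 0" using degree_orth[of a b n] apos by blast
  ultimately have "c (Suc n) = 0"
    unfolding Suc.prems(1) by (simp del: orth.simps)
  then show ?case using Suc by (cases "i = Suc n") (auto simp del: orth.simps)
qed simp

text \<open>The n vectors of values at the n zeros are mutually orthogonal by Christoffel-Darboux.
  Normalised, they are the rows of an orthogonal matrix, and the claim is the orthonormality of its
  columns; the weights are the Christoffel numbers.\<close>

lemma gauss_quadrature: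
  assumes "1 \<le> i" "i \<le> n" "1 \<le> j" "j \<le> n"
  shows "(\<Sum>x\<in>orth_roots a b n. poly (u i) x * poly (u j) x / (\<Sum>k=1..n. (poly (u k) x)\<^sup>2))
     = (if i = j then 1 else 0)"
proof -
  define Z where "Z = orth_roots a b n"
  define K where "K x = (\<Sum>k=1..n. (poly (u k) x)\<^sup>2)" for x
  define c where "c j = (\<Sum>x\<in>Z. poly (u i) x * poly (u j) x / K x)" for j
  have Kpos: "K x > 0" for x unfolding K_def using sum_u_sq_pos[of n x] assms by simp
  have ortho: "(\<Sum>k=1..n. poly (u k) x * poly (u k) y) = 0" if "x \<in> Z" "y \<in> Z" "x \<noteq> y" for x y
  proof -
    have "of_real ((x - y) * (\<Sum>k=1..n. poly (u k) x * poly (u k) y)) = (0::complex)"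
      using christoffel_darboux[of "of_real x" "of_real y" n] that(1,2)
      unfolding cu_of_real Z_def orth_roots_def by simp
    then have "(x - y) * (\<Sum>k=1..n. poly (u k) x * poly (u k) y) = 0"
      by (simp only: of_real_eq_0_iff)
    then show ?thesis using that(3) by simp
  qed
  \<comment> \<open>Its coefficients in the basis \<open>u\<close> are the defects to be shown zero.
    Degree below n together with n zeros forces \<open>R = 0\<close>, in place of a matrix
    inversion.\<close>
  define R where "R = (\<Sum>k=1..n. smult (c k - (if k = i then 1 else 0)) (u k))"
  have "poly R y = 0" if y: "y \<in> Z" for y
  proof -
    have "(\<Sum>k=1..n. c k * poly (u k) y) = (\<Sum>x\<in>Z. poly (u i) x / K x * (\<Sum>k=1..n. poly (u k) x * poly (u k) y))"
      unfolding c_def sum_distrib_right sum_distrib_left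
      by (subst sum.swap) (simp add: mult_ac)
    also have "\<dots> = (\<Sum>x\<in>Z. if x = y then poly (u i) y else 0)"
    proof (intro sum.cong refl)
      fix x assume "x \<in> Z"
      show "poly (u i) x / K x * (\<Sum>k=1..n. poly (u k) x * poly (u k) y) = (if x = y then poly (u i) y else 0)"
      proof (cases "x = y")
        case True
        then show ?thesis using Kpos[of y] by (simp add: K_def power2_eq_square)
      next
        case False
        then show ?thesis using ortho[OF \<open>x \<in> Z\<close> y] by simp
      qed
    qed
    also have "\<dots> = poly (u i) y" using y by (simp add: Z_def)
    finally have s: "(\<Sum>k=1..n. c k * poly (u k) y) = poly (u i) y" .
    have "poly R y = (\<Sum>k=1..n. c k * poly (u k) y - (if k = i then poly (u i) y else 0))"
      unfolding R_def poly_sum by (intro sum.cong) (auto simp: algebra_simps)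
    also have "\<dots> = 0" using s assms by (simp add: sum_subtractf)
    finally show ?thesis .
  qed
  then have sub: "Z \<subseteq> {x. poly R x = 0}" by auto
  have "R = 0"
  proof (rule ccontr)
    assume R: "R \<noteq> 0"
    have "degree R \<le> n - 1"
      unfolding R_def
    proof (rule degree_sum_le)
      fix k assume "k \<in> {1..n}"
      then show "degree (smult (c k - (if k = i then 1 else 0)) (u k)) \<le> n - 1"
        using degree_u[of "k - 1"] by (intro order.trans[OF degree_smult_le]) auto
    qed simp
    moreover have "n \<le> card {x. poly R x = 0}"
      using card_mono[OF poly_roots_finite[OF R] sub] card_orth_roots[of n] by (simp add: Z_def)
    ultimately show False using card_poly_roots_bound[OF R] assms by linarith
  qed
  then have "c j - (if j = i then 1 else 0) = 0"
    unfolding R_def by (rule orth_indep) (use assms in auto)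
  then show ?thesis by (auto simp: c_def K_def Z_def)
qed

text \<open>The power sum is the trace of the l-th power of the truncation, whose diagonal agrees
  with that of J^l except in the last l rows; each of these costs at most
  \<open>2 * (2 * A + B) ^ l\<close>.\<close>

lemma trace_estimate:
  assumes A: "\<And>k. k \<ge> 1 \<Longrightarrow> \<bar>a k\<bar> \<le> A" and B: "\<And>k. k \<ge> 1 \<Longrightarrow> \<bar>b k\<bar> \<le> B"
  shows "\<bar>(\<Sum>x\<in>orth_roots a b n. x ^ l) - (\<Sum>i=1..n. walk (zext a) (zext b) l (int i) (int i))\<bar>
    \<le> real l * (2 * (2 * A + B) ^ l)"
proof -
  define Z where "Z = orth_roots a b n"
  define K where "K x = (\<Sum>k=1..n. (poly (u k) x)\<^sup>2)" for x
  \<comment> \<open>The (i,j) entry of the l-th power of the truncation, by its spectral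
    decomposition.\<close>
  define G where "G l i j = (\<Sum>x\<in>Z. x ^ l * (poly (u i) x * poly (u j) x / K x))" for l i j
  define w where "w i = walk (zext a) (zext b) l (int i) (int i)" for i
  define C where "C = 2 * A + B"
  have C0: "C \<ge> 0" using A[of 1] B[of 1] by (auto simp: C_def)
  have eq: "G l i i = w i" if i: "1 \<le> i" "i + l \<le> n" for i
    unfolding w_def
  proof (rule walk_zext_unique[where n = n and G = "\<lambda>l k. G l k i"])
    fix k assume "1 \<le> k" "k \<le> n"
    then show "G 0 k i = (if k = i then 1 else 0)"
      using gauss_quadrature[of k n i] i by (simp add: G_def Z_def K_def)
  next
    fix l k assume k: "1 \<le> k" "k \<le> n"
    have "G (Suc l) k i = (\<Sum>x\<in>Z. x ^ l * (x * poly (u k) x) * poly (u i) x / K x)"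
      by (simp add: G_def mult_ac)
    also have "\<dots> = a k * G l (Suc k) i + b k * G l k i + a (k - 1) * G l (k - 1) i"
      unfolding poly_u_rec'[OF k(1)] G_def sum_distrib_left sum.distrib[symmetric]
      by (intro sum.cong refl) (simp add: field_simps add_divide_distrib)
    finally show "G (Suc l) k i = a k * G l (Suc k) i + b k * G l k i + a (k - 1) * G l (k - 1) i" .
  qed (use i in \<open>auto simp: G_def\<close>)
  have Zb: "\<bar>x\<bar> \<le> C" if "x \<in> Z" for x
    using orth_roots_bound[of x n A B] that A B by (simp add: C_def Z_def)
  have gb: "\<bar>G l i i\<bar> \<le> C ^ l" if i: "1 \<le> i" "i \<le> n" for i
  proof -
    have Kp: "K x > 0" for x unfolding K_def using sum_u_sq_pos[of n x] i by simp
    have "\<bar>G l i i\<bar> \<le> (\<Sum>x\<in>Z. \<bar>x ^ l * (poly (u i) x * poly (u i) x / K x)\<bar>)"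
      unfolding G_def by (rule sum_abs)
    also have "\<dots> \<le> (\<Sum>x\<in>Z. C ^ l * (poly (u i) x * poly (u i) x / K x))"
      unfolding abs_mult power_abs using Zb Kp
      by (intro sum_mono mult_mono power_mono) (auto intro!: divide_nonneg_pos simp: less_imp_le abs_mult C0)
    also have "\<dots> = C ^ l" using gauss_quadrature[of i n i] i
      unfolding sum_distrib_left[symmetric] Z_def K_def by simp
    finally show ?thesis .
  qed
  have wb: "\<bar>w i\<bar> \<le> C ^ l" for i
    unfolding w_def C_def by (intro walk_bound abs_zext_le A B)
  have tr: "(\<Sum>x\<in>Z. x ^ l) = (\<Sum>i=1..n. G l i i)"
  proof (cases "n = 0")
    case True
    then have "Z = {}" using card_orth_roots[of 0] by (simp add: Z_def)
    then show ?thesis using True by simp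
  next
    case False
    then have Kp: "K x > 0" for x unfolding K_def using sum_u_sq_pos[of n x] by simp
    have "(\<Sum>i=1..n. G l i i) = (\<Sum>x\<in>Z. \<Sum>i=1..n. x ^ l * (poly (u i) x * poly (u i) x / K x))"
      unfolding G_def by (rule sum.swap)
    also have "\<dots> = (\<Sum>x\<in>Z. x ^ l * ((\<Sum>i=1..n. poly (u i) x * poly (u i) x) / K x))"
      by (simp add: sum_distrib_left sum_divide_distrib)
    also have "\<dots> = (\<Sum>x\<in>Z. x ^ l)"
    proof (intro sum.cong refl)
      fix x
      have "(\<Sum>i=1..n. poly (u i) x * poly (u i) x) = K x" by (simp add: K_def power2_eq_square)
      then show "x ^ l * ((\<Sum>i=1..n. poly (u i) x * poly (u i) x) / K x) = x ^ l"
        using Kp[of x] by simp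
    qed
    finally show ?thesis ..
  qed
  have "\<bar>(\<Sum>x\<in>Z. x ^ l) - (\<Sum>i=1..n. w i)\<bar> = \<bar>\<Sum>i=1..n. (G l i i - w i)\<bar>"
    by (simp add: tr sum_subtractf)
  also have "\<dots> = \<bar>\<Sum>i\<in>{i\<in>{1..n}. n < i + l}. (G l i i - w i)\<bar>"
  proof (intro arg_cong[where f = abs] sum.mono_neutral_right ballI)
    fix i assume "i \<in> {1..n} - {i \<in> {1..n}. n < i + l}"
    then have "1 \<le> i" "i + l \<le> n" by auto
    then show "G l i i - w i = 0" using eq by simp
  qed auto
  also have "\<dots> \<le> (\<Sum>i\<in>{i\<in>{1..n}. n < i + l}. \<bar>G l i i - w i\<bar>)" by (rule sum_abs)
  also have "\<dots> \<le> (\<Sum>i\<in>{i\<in>{1..n}. n < i + l}. 2 * C ^ l)"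
  proof (intro sum_mono)
    fix i assume "i \<in> {i\<in>{1..n}. n < i + l}"
    then show "\<bar>G l i i - w i\<bar> \<le> 2 * C ^ l" using gb[of i] wb[of i] by auto
  qed
  also have "\<dots> = real (card {i\<in>{1..n}. n < i + l}) * (2 * C ^ l)" by simp
  also have "\<dots> \<le> real l * (2 * C ^ l)"
  proof (intro mult_right_mono)
    have "card {i\<in>{1..n}. n < i + l} \<le> card {n<..<n + l + 1}"
    proof (rule card_inj_on_le[where f = "\<lambda>i. i + l"])
    qed (auto simp: inj_on_def)
    then show "real (card {i\<in>{1..n}. n < i + l}) \<le> real l" by simp
  qed (use C0 in auto)
  finally show ?thesis by (simp add: Z_def w_def C_def)
qed

end

section \<open>From window averages to means over all sites\<close>

text \<open>Only increments over windows of length p converge, not single ones. Comparing n with n -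
  p gives \<open>\<bar>S n - c * real n\<bar> \<le> M + e * real n\<close> for every e > 0.\<close>

lemma window_average_linear_growth:
  fixes S :: "nat \<Rightarrow> real"
  assumes p: "p \<ge> 1" and lim: "(\<lambda>n. (S (n + p) - S n) / real p) \<longlonglongrightarrow> c"
  shows "(\<lambda>n. S n / real n) \<longlonglongrightarrow> c"
proof -
  define T where "T n = S n - c * real n" for n
  have bnd: "\<exists>M. \<forall>n. \<bar>T n\<bar> \<le> M + e * real n" if e: "e > 0" for e
  proof -
    obtain n0 where n0: "\<And>n. n \<ge> n0 \<Longrightarrow> \<bar>(S (n + p) - S n) / real p - c\<bar> < e"
      using LIMSEQ_D[OF lim e] by auto
    define M where "M = Max ((\<lambda>n. \<bar>T n\<bar>) ` {..<n0 + p})"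
    have "\<bar>T n\<bar> \<le> M + e * real n" for n
    proof (induction n rule: less_induct)
      case (less n)
      show ?case
      proof (cases "n < n0 + p")
        case True
        then have "\<bar>T n\<bar> \<le> M" unfolding M_def by (intro Max_ge) auto
        then show ?thesis using e by (simp add: add_increasing2)
      next
        case False
        define m where "m = n - p"
        have m: "n = m + p" "m \<ge> n0" "m < n" using False p by (auto simp: m_def)
        have "T n - T m = real p * ((S (m + p) - S m) / real p - c)"
          using p m(1) by (simp add: T_def field_simps)
        then have "\<bar>T n - T m\<bar> \<le> real p * e"
          using n0[OF m(2)] p by (simp add: abs_mult)
        moreover have "\<bar>T m\<bar> \<le> M + e * real m" using less m by simp
        ultimately have "\<bar>T n\<bar> \<le> M + e * real m + real p * e" by linarith
        then show ?thesis using m(1) by (simp add: algebra_simps)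
      qed
    qed
    then show ?thesis by blast
  qed
  have "(\<lambda>n. T n / real n) \<longlonglongrightarrow> 0"
  proof (rule LIMSEQ_I)
    fix r :: real assume r: "r > 0"
    obtain M where M: "\<And>n. \<bar>T n\<bar> \<le> M + r / 2 * real n" using bnd[of "r / 2"] r by auto
    obtain n1 :: nat where n1: "2 * M / r < real n1" using reals_Archimedean2 by blast
    have "norm (T n / real n - 0) < r" if "n \<ge> Suc n1" for n
    proof -
      have n: "real n > 0" "2 * M / r < real n" using that n1 by auto
      then have "2 * M < real n * r" using r by (simp add: pos_divide_less_eq)
      then have "\<bar>T n\<bar> < r * real n" using M[of n] by (simp add: algebra_simps)
      then show ?thesis using n by (simp add: pos_divide_less_eq)
    qed
    then show "\<exists>no. \<forall>n\<ge>no. norm (T n / real n - 0) < r" by blast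
  qed
  then have "(\<lambda>n. T n / real n + c) \<longlonglongrightarrow> 0 + c" by (intro tendsto_intros)
  moreover have "\<forall>\<^sub>F n in sequentially. T n / real n + c = S n / real n"
    using eventually_gt_at_top[of 0] by eventually_elim (simp add: T_def field_simps)
  ultimately have "(\<lambda>n. S n / real n) \<longlonglongrightarrow> 0 + c" by (rule Lim_transform_eventually)
  then show ?thesis by simp
qed

text \<open>The error in the trace estimate does not depend on n, so division by n removes it. Used
  for J itself and, with a known zero set, for periodic matrices.\<close>

lemma (in jacobi) root_moments_tendsto:
  assumes A: "\<And>k. k \<ge> 1 \<Longrightarrow> \<bar>a k\<bar> \<le> A" and B: "\<And>k. k \<ge> 1 \<Longrightarrow> \<bar>b k\<bar> \<le> B"
    and p: "p \<ge> 1"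
    and lim: "(\<lambda>n. (1 / real p) * (\<Sum>j=1..p. walk (zext a) (zext b) l (int (j + n)) (int (j + n)))) \<longlonglongrightarrow> c"
  shows "(\<lambda>n. (1 / real n) * (\<Sum>x\<in>orth_roots a b n. x ^ l)) \<longlonglongrightarrow> c"
proof -
  define w where "w i = walk (zext a) (zext b) l (int i) (int i)" for i
  define S where "S n = (\<Sum>i=1..n. w i)" for n
  have d: "S (n + p) - S n = (\<Sum>j=1..p. w (j + n))" for n
  proof -
    have "(\<Sum>j=1..p. w (j + n)) = (\<Sum>i=1+n..p+n. w i)"
      by (rule sum.shift_bounds_cl_nat_ivl[symmetric])
    moreover have "S (n + p) = S n + (\<Sum>i=n+1..n+p. w i)"
      unfolding S_def by (subst sum.ub_add_nat) auto
    ultimately show ?thesis by (simp add: add.commute)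
  qed
  have 1: "(\<lambda>n. S n / real n) \<longlonglongrightarrow> c"
    by (rule window_average_linear_growth[OF p]) (use lim in \<open>simp add: d w_def\<close>)
  define E where "E n = (\<Sum>x\<in>orth_roots a b n. x ^ l) - S n" for n
  have "(\<lambda>n. E n / real n) \<longlonglongrightarrow> 0"
  proof (rule Lim_null_comparison)
    show "\<forall>\<^sub>F n in sequentially. norm (E n / real n) \<le> (real l * (2 * (2 * A + B) ^ l)) / real n"
    proof (intro always_eventually allI)
      fix n
      show "norm (E n / real n) \<le> (real l * (2 * (2 * A + B) ^ l)) / real n"
        using trace_estimate[OF A B, of l n] by (simp add: E_def S_def w_def divide_right_mono)
    qed
    show "(\<lambda>n. (real l * (2 * (2 * A + B) ^ l)) / real n) \<longlonglongrightarrow> 0"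
      by (rule lim_const_over_n)
  qed
  from tendsto_add[OF this 1] show ?thesis
    by (simp add: E_def add_divide_distrib[symmetric])
qed

section \<open>Orthonormal polynomials of the spectral measure\<close>

text \<open>The functional sending x^k to \<open>c k\<close>. For
  \<open>c k = jac_pow a b k 1 j\<close> it is the (1,j) entry of q(J); j = 1 is integration against
  \<mu>, and the other columns serve the induction in \<open>row_functional\<close>.\<close>

definition coeff_functional :: "(nat \<Rightarrow> real) \<Rightarrow> real poly \<Rightarrow> real" where
  "coeff_functional c q = (\<Sum>k\<le>degree q. coeff q k * c k)"

lemma coeff_functional_le:
  assumes "degree q \<le> N"
  shows "coeff_functional c q = (\<Sum>k\<le>N. coeff q k * c k)"
  unfolding coeff_functional_def using assms
  by (intro sum.mono_neutral_left) (auto intro: coeff_eq_0)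

lemma coeff_functional_add:
  "coeff_functional c (p + q) = coeff_functional c p + coeff_functional c q"
proof -
  define N where "N = max (degree p) (degree q)"
  have "degree p \<le> N" "degree q \<le> N" "degree (p + q) \<le> N"
    by (auto simp: N_def degree_add_le_max)
  then show ?thesis
    by (simp add: coeff_functional_le[of _ N] sum.distrib[symmetric] distrib_right)
qed

lemma coeff_functional_smult: "coeff_functional c (smult s q) = s * coeff_functional c q"
  by (subst coeff_functional_le[OF degree_smult_le])
     (simp add: coeff_functional_def sum_distrib_left mult.assoc)

lemma coeff_functional_one: "coeff_functional c 1 = c 0"
  by (simp add: coeff_functional_def)

lemma coeff_functional_zero: "coeff_functional c 0 = 0"
  by (simp add: coeff_functional_def)

lemma coeff_functional_x: "coeff_functional c ([:0, 1:] * q) = coeff_functional (\<lambda>k. c (Suc k)) q"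
proof -
  have "degree ([:0, 1:] * q) \<le> Suc (degree q)" by (simp add: degree_pCons_le)
  then have "coeff_functional c ([:0, 1:] * q) = (\<Sum>k\<le>Suc (degree q). coeff ([:0, 1:] * q) k * c k)"
    by (rule coeff_functional_le)
  also have "\<dots> = (\<Sum>k\<le>degree q. coeff q k * c (Suc k))"
    by (subst sum.atMost_Suc_shift) simp
  finally show ?thesis by (simp add: coeff_functional_def)
qed

text \<open>\<open>jac_pow\<close> multiplies by J on the right, so this recursion runs in the
  column index, unlike that of \<open>walk\<close>.\<close>

lemma jac_pow_row:
  "jac_pow a b (Suc k) i (Suc n) = (if n = 0 then 0 else a n * jac_pow a b k i n)
     + b (Suc n) * jac_pow a b k i (Suc n) + a (Suc n) * jac_pow a b k i (Suc (Suc n))"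
proof (cases n)
  case 0
  then show ?thesis by (simp add: jac_entry_def numeral_2_eq_2)
next
  case (Suc m)
  have z: "(\<Sum>l=1..m. jac_pow a b k i l * jac_entry a b l (Suc (Suc m))) = 0"
    by (intro sum.neutral) (auto simp: jac_entry_def)
  show ?thesis using z Suc by (simp add: jac_entry_def)
qed

lemma triangular_expansion:
  fixes v :: "nat \<Rightarrow> real poly"
  assumes v: "\<And>n. degree (v n) = n \<and> lead_coeff (v n) > 0"
    and R: "\<And>k. n \<le> k \<Longrightarrow> coeff R k = 0"
  shows "\<exists>c. R = (\<Sum>i<n. smult (c i) (v i))"
  using R
proof (induction n arbitrary: R)
  case 0
  then show ?case by (simp add: poly_eq_iff)
next
  case (Suc n)
  define s where "s = coeff R n / coeff (v n) n"
  have "coeff (R - smult s (v n)) k = 0" if k: "n \<le> k" for k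
  proof (cases "k = n")
    case True
    moreover have "coeff (v n) n > 0" using v[of n] by auto
    ultimately show ?thesis by (simp add: s_def)
  next
    case False
    then show ?thesis using Suc.prems[of k] v[of n] k by (simp add: coeff_eq_0)
  qed
  from Suc.IH[OF this] obtain c where c: "R - smult s (v n) = (\<Sum>i<n. smult (c i) (v i))" by blast
  have "R = (\<Sum>i<Suc n. smult ((c(n := s)) i) (v i))"
    using c by (simp add: algebra_simps)
  then show ?case by blast
qed

text \<open>Matching leading coefficients by \<open>s\<close>, the difference \<open>R\<close> has
  lower degree, hence is orthogonal to \<open>v n\<close> and \<open>w n\<close>, and F(R^2) = 0.
  Expanding in the orthonormal \<open>w\<close> turns this into a vanishing sum of squares, which
  supplies definiteness for the merely linear \<open>F\<close>.\<close>

lemma orthonormal_family_unique: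
  fixes v w :: "nat \<Rightarrow> real poly" and F :: "real poly \<Rightarrow> real"
  assumes add: "\<And>p q. F (p + q) = F p + F q" and smult: "\<And>c p. F (smult c p) = c * F p"
    and v: "\<And>n. degree (v n) = n \<and> lead_coeff (v n) > 0"
    and w: "\<And>n. degree (w n) = n \<and> lead_coeff (w n) > 0"
    and ov: "\<And>n m. F (v n * v m) = (if n = m then 1 else 0)"
    and ow: "\<And>n m. F (w n * w m) = (if n = m then 1 else 0)"
  shows "v n = w n"
proof -
  have F0: "F 0 = 0" using smult[of 0 0] by simp
  have Fsum: "F (\<Sum>i\<in>A. f i) = (\<Sum>i\<in>A. F (f i))" if "finite A" for A and f :: "nat \<Rightarrow> _"
    using that by (induction A rule: finite_induct) (auto simp: F0 add)
  have expand: "F (q * (\<Sum>i<n. smult (c i) (f i))) = (\<Sum>i<n. c i * F (q * f i))" for q c f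
    by (simp add: sum_distrib_left Fsum smult)
  define s where "s = lead_coeff (v n) / lead_coeff (w n)"
  have s: "s > 0" using v[of n] w[of n] unfolding s_def by (auto intro: divide_pos_pos)
  define R where "R = v n - smult s (w n)"
  have R: "coeff R k = 0" if "n \<le> k" for k
  proof (cases "k = n")
    case True
    moreover have "coeff (w n) n > 0" using w[of n] by auto
    ultimately show ?thesis using v[of n] w[of n] by (simp add: R_def s_def)
  next
    case False
    then show ?thesis using that v[of n] w[of n] by (simp add: R_def coeff_eq_0)
  qed
  obtain c where c: "R = (\<Sum>i<n. smult (c i) (v i))" using triangular_expansion[OF v R] by blast
  obtain d where d: "R = (\<Sum>i<n. smult (d i) (w i))" using triangular_expansion[OF w R] by blast
  have vR: "F (v n * R) = 0" unfolding c expand by (simp add: ov)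
  have wR: "F (w n * R) = 0" unfolding d expand by (simp add: ow)
  have "R * R = v n * R + smult (- s) (w n * R)"
    by (subst (1) R_def) (simp add: left_diff_distrib)
  then have "F (R * R) = F (v n * R + smult (- s) (w n * R))" by (rule arg_cong)
  then have RR: "F (R * R) = 0" unfolding add smult vR wR by simp
  have dR: "F (R * w i) = d i" if "i < n" for i
  proof -
    have "F (w i * R) = (\<Sum>j<n. d j * F (w i * w j))" unfolding d expand ..
    also have "\<dots> = (\<Sum>j<n. if j = i then d j else 0)"
      by (intro sum.cong) (auto simp: ow)
    also have "\<dots> = d i" using that by simp
    finally show ?thesis by (simp add: mult.commute)
  qed
  have "F (R * R) = (\<Sum>i<n. d i * F (R * w i))"
    by (subst (2) d) (rule expand)
  also have "\<dots> = (\<Sum>i<n. (d i)\<^sup>2)" by (intro sum.cong) (auto simp: dR power2_eq_square)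
  finally have "(\<Sum>i<n. (d i)\<^sup>2) = 0" using RR by simp
  then have "\<forall>i\<in>{..<n}. (d i)\<^sup>2 = 0"
    by (subst (asm) sum_nonneg_eq_0_iff) auto
  then have "R = 0" unfolding d by simp
  then have vw: "v n = smult s (w n)" by (simp add: R_def)
  have "1 = F (v n * v n)" by (simp add: ov)
  also have "\<dots> = s * s" unfolding vw by (simp add: smult ow)
  finally have "s = 1" using s by (metis power2_eq_square real_sqrt_unique real_sqrt_one less_imp_le)
  then show ?thesis using vw by simp
qed

locale spectral_jacobi = jacobi +
  fixes \<mu> :: "real measure"
  assumes spectral: "is_spectral_measure a b \<mu>"
begin

lemma sets_mu [measurable_cong, simp]: "sets \<mu> = sets borel"
  using spectral by (simp add: is_spectral_measure_def)

sublocale finite_measure \<mu>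
  using spectral by (simp add: is_spectral_measure_def)

definition F :: "real poly \<Rightarrow> real" where
  "F = coeff_functional (\<lambda>k. jac_pow a b k 1 1)"

lemma space_mu [simp]: "space \<mu> = UNIV"
  using sets_eq_imp_space_eq[OF sets_mu] by simp

lemma F_add: "F (p + q) = F p + F q" and F_smult: "F (smult c p) = c * F p"
  by (simp_all add: F_def coeff_functional_add coeff_functional_smult)

lemma integrable_poly [simp]: "integrable \<mu> (poly q)"
  using spectral unfolding poly_altdef is_spectral_measure_def
  by (intro Bochner_Integration.integrable_sum integrable_mult_right) auto

lemma integral_poly: "(\<integral>x. poly q x \<partial>\<mu>) = F q"
proof -
  have "(\<integral>x. poly q x \<partial>\<mu>) = (\<Sum>k\<le>degree q. \<integral>x. coeff q k * x ^ k \<partial>\<mu>)"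
    unfolding poly_altdef
    using spectral unfolding is_spectral_measure_def
    by (intro Bochner_Integration.integral_sum integrable_mult_right) auto
  also have "\<dots> = F q"
    using spectral unfolding F_def coeff_functional_def is_spectral_measure_def by simp
  finally show ?thesis .
qed

text \<open>This is u_i(J) \<delta>_1 = \<delta>_i: the recursion of \<open>u\<close> is the action
  of J, and both sides start from \<open>u 1 = 1\<close>.\<close>

lemma row_functional:
  "j \<ge> 1 \<Longrightarrow> coeff_functional (\<lambda>k. jac_pow a b k 1 j) (u i) = (if i = j then 1 else 0)"
proof (induction i arbitrary: j rule: orth.induct[of "\<lambda>_ _. _"])
  case (1 a' b')
  then show ?case by (simp add: coeff_functional_zero)
next
  case (2 a' b')
  then show ?case by (simp add: coeff_functional_one)
next
  case (3 a' b' n)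
  define L where "L j = coeff_functional (\<lambda>k. jac_pow a b k 1 j)" for j
  obtain m where m: "j = Suc m" using 3 by (cases j) auto
  have IH: "L j (u (Suc n)) = (if Suc n = j then 1 else 0)" "L j (u n) = (if n = j then 1 else 0)"
    if "j \<ge> 1" for j using 3 that by (simp_all add: L_def)
  \<comment> \<open>Multiplying q by x raises each power of J by one, and the extra factor acts on
    column j.\<close>
  have "L j ([:0, 1:] * q) = (if m = 0 then 0 else a m * L m q) + b j * L j q + a j * L (Suc j) q" for q
    unfolding L_def coeff_functional_x m jac_pow_row
    unfolding coeff_functional_def
    by (simp add: sum.distrib sum_distrib_left distrib_left mult.left_commute del: jac_pow.simps)
  from this[of "u (Suc n)"]
  have "a (Suc n) * L j (u (Suc (Suc n))) + b (Suc n) * L j (u (Suc n)) + a n * L j (u n)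
     = (if m = 0 then 0 else a m * L m (u (Suc n))) + b j * L j (u (Suc n)) + a j * L (Suc j) (u (Suc n))"
    unfolding u_rec L_def
      coeff_functional_add coeff_functional_smult by simp
  then have "a (Suc n) * L j (u (Suc (Suc n))) = a (Suc n) * (if Suc (Suc n) = j then 1 else 0)"
    using IH[of j] IH[of m] IH[of "Suc j"] m by (auto split: if_splits simp del: orth.simps)
  then show ?case using apos[of "Suc n"] by (simp add: L_def del: orth.simps)
qed

text \<open>Multiplication by x is symmetric for \<open>F\<close>; expanding it on either factor by
  the recursion determines the new inner product. The start j = 1 is \<open>row_functional\<close>
  at column 1.\<close>

lemma F_ortho: "i \<ge> 1 \<Longrightarrow> F (u i * u j) = (if i = j then 1 else 0)"
proof (induction j arbitrary: i rule: orth.induct[of "\<lambda>_ _. _"])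
  case (1 a' b')
  then show ?case by (simp add: F_def coeff_functional_zero)
next
  case (2 a' b')
  then show ?case using row_functional[of 1 i] by (simp add: F_def)
next
  case (3 a' b' n)
  obtain m where m: "i = Suc m" using 3 by (cases i) auto
  have IH: "F (u i * u (Suc n)) = (if i = Suc n then 1 else 0)" "F (u i * u n) = (if i = n then 1 else 0)"
    if "i \<ge> 1" for i using 3 that by simp_all
  have IH0: "F (u 0 * u (Suc n)) = 0" by (simp add: F_def coeff_functional_zero)
  have "F (u i * ([:0, 1:] * u (Suc n))) = F (([:0, 1:] * u i) * u (Suc n))"
    by (simp only: mult_ac)
  then have "a (Suc n) * F (u i * u (Suc (Suc n))) + b (Suc n) * F (u i * u (Suc n)) + a n * F (u i * u n)
    = a i * F (u (Suc i) * u (Suc n)) + b i * F (u i * u (Suc n)) + a m * F (u m * u (Suc n))"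
    unfolding m u_rec
    by (simp add: distrib_left distrib_right F_add F_smult del: orth.simps)
  then have "a (Suc n) * F (u i * u (Suc (Suc n))) = a (Suc n) * (if i = Suc (Suc n) then 1 else 0)"
    using IH[of i] IH[of m] IH[of "Suc i"] IH0 m by (cases "m = 0") (auto split: if_splits simp del: orth.simps)
  then show ?case using apos[of "Suc n"] by (simp del: orth.simps)
qed

lemma orthonormal_polys_eq:
  assumes "is_orthonormal_polys \<mu> P" shows "P n = u (Suc n)"
proof (rule orthonormal_family_unique[of F P "\<lambda>n. u (Suc n)"])
  fix n m
  have "F (P n * P m) = (\<integral>x. poly (P n) x * poly (P m) x \<partial>\<mu>)"
    unfolding integral_poly[symmetric] by (rule Bochner_Integration.integral_cong) simp_all
  then show "F (P n * P m) = (if n = m then 1 else 0)"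
    using assms by (simp add: is_orthonormal_polys_def)
  show "F (u (Suc n) * u (Suc m)) = (if n = m then 1 else 0)" using F_ortho[of "Suc n" "Suc m"] by simp
  show "degree (u (Suc n)) = n \<and> 0 < lead_coeff (u (Suc n))" using degree_orth[of a b n] apos by blast
  show "degree (P n) = n \<and> 0 < lead_coeff (P n)"
    using assms unfolding is_orthonormal_polys_def by blast
qed (auto simp: F_add F_smult)

text \<open>For fixed i the integrals of x^l u_k u_i obey in k the recursion of J^l, and
  orthonormality gives the start l = 0.\<close>

lemma integral_moment:
  assumes "i \<ge> 1"
  shows "(\<integral>x. x ^ l * (poly (u i) x)\<^sup>2 \<partial>\<mu>) = walk (zext a) (zext b) l (int i) (int i)"
proof -
  define G where "G l k = F (monom 1 l * (u k * u i))" for l k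
  have "G l i = walk (zext a) (zext b) l (int i) (int i)"
  proof (rule walk_zext_unique[where n = "i + l"])
    fix k :: nat assume "1 \<le> k"
    then show "G 0 k = (if k = i then 1 else 0)" by (simp add: G_def F_ortho)
  next
    fix l show "G l 0 = 0" by (simp add: G_def F_def coeff_functional_zero)
  next
    fix l k :: nat assume k: "1 \<le> k"
    then obtain m where m: "k = Suc m" by (cases k) auto
    have "monom 1 (Suc l) = monom 1 l * [:0, 1::real:]"
      by (simp add: monom_Suc mult.commute)
    then have "G (Suc l) k = F (monom 1 l * (([:0, 1:] * u k) * u i))"
      unfolding G_def by (simp only: mult.assoc)
    also have "\<dots> = a k * G l (Suc k) + b k * G l k + a (k - 1) * G l (k - 1)"
      unfolding m u_rec G_def
      by (simp add: distrib_left distrib_right F_add F_smult del: orth.simps)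
    finally show "G (Suc l) k = a k * G l (Suc k) + b k * G l k + a (k - 1) * G l (k - 1)" .
  qed (use assms in auto)
  moreover have "G l i = (\<integral>x. x ^ l * (poly (u i) x)\<^sup>2 \<partial>\<mu>)"
    unfolding G_def integral_poly[symmetric]
    by (rule Bochner_Integration.integral_cong) (simp_all add: poly_monom power2_eq_square)
  ultimately show ?thesis by simp
qed

text \<open>Markov's inequality for x^(2k): the mass outside [-C, C] is at most
  \<open>(D / C) ^ (2 * k)\<close> for every k, where D = 2 A + B < C.\<close>

lemma AE_bound:
  assumes A: "\<And>k. k \<ge> 1 \<Longrightarrow> \<bar>a k\<bar> \<le> A" and B: "\<And>k. k \<ge> 1 \<Longrightarrow> \<bar>b k\<bar> \<le> B"
    and C: "2 * A + B < C"
  shows "AE x in \<mu>. \<bar>x\<bar> \<le> C"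
proof -
  define D where "D = 2 * A + B"
  have D0: "D \<ge> 0" using A[of 1] B[of 1] by (auto simp: D_def)
  have CD: "D < C" "C > 0" using C D0 by (auto simp: D_def)
  define E where "E = {x. C < \<bar>x\<bar>}"
  have E[measurable]: "E \<in> sets \<mu>" unfolding E_def by simp
  have le: "measure \<mu> E \<le> (D / C) ^ (2 * k)" for k
  proof -
    have "C ^ (2 * k) * measure \<mu> E = (\<integral>x. C ^ (2 * k) * indicator E x \<partial>\<mu>)" by simp
    also have "\<dots> \<le> (\<integral>x. poly (monom 1 (2 * k)) x \<partial>\<mu>)"
    proof (rule integral_mono)
      fix x :: real
      have "C ^ (2 * k) \<le> \<bar>x\<bar> ^ (2 * k)" if "C < \<bar>x\<bar>"
        using that CD by (intro power_mono) auto
      moreover have "\<bar>x\<bar> ^ (2 * k) = x ^ (2 * k)" "x ^ (2 * k) \<ge> 0"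
        by (simp_all add: power_even_abs)
      ultimately show "C ^ (2 * k) * indicator E x \<le> poly (monom 1 (2 * k)) x"
        by (auto simp: E_def poly_monom split: split_indicator)
    next
      show "integrable \<mu> (\<lambda>x. C ^ (2 * k) * indicator E x)"
        by (intro integrable_mult_right integrable_real_indicator E) (simp add: emeasure_eq_measure)
    qed simp
    also have "\<dots> = walk (zext a) (zext b) (2 * k) 1 1"
      using integral_moment[of 1 "2 * k"] by (simp add: poly_monom)
    also have "\<dots> \<le> D ^ (2 * k)"
      using walk_bound[of "zext a" A "zext b" B "2 * k" 1 1] abs_zext_le[of a A] abs_zext_le[of b B] A B
      by (simp add: D_def abs_le_iff)
    finally show ?thesis using CD by (simp add: power_divide field_simps)
  qed
  have "(\<lambda>k. ((D / C)\<^sup>2) ^ k) \<longlonglongrightarrow> 0"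
    using CD D0 by (intro LIMSEQ_power_zero) (auto simp: power_divide abs_square_less_1 power2_eq_square
        intro!: mult_strict_mono)
  then have "measure \<mu> E \<le> 0"
    by (rule LIMSEQ_le_const) (use le in \<open>auto simp: power_mult\<close>)
  then have "emeasure \<mu> E = 0" by (simp add: emeasure_eq_measure measure_le_0_iff)
  then show ?thesis
    using AE_iff_measurable[OF E, of "\<lambda>x. \<bar>x\<bar> \<le> C"]
    by (auto simp: E_def not_le)
qed

end

section \<open>Periodic matrices\<close>

text \<open>The free matrix: \<open>cheb n\<close> is the Chebyshev polynomial of the second kind
  \<open>U (n - 1)\<close> at half its argument.\<close>

abbreviation cheb :: "nat \<Rightarrow> real poly" where
  "cheb \<equiv> orth (\<lambda>_. 1) (\<lambda>_. 0)"

lemma cheb_sin: "sin t * poly (cheb n) (2 * cos t) = sin (real n * t)"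
proof (induction n rule: orth.induct[of "\<lambda>_ _. _"])
  case (3 a b n)
  have "sin (real (Suc (Suc n)) * t) = sin (real (Suc n) * t + t)"
    "sin (real n * t) = sin (real (Suc n) * t - t)"
    by (simp_all add: algebra_simps)
  then have "sin (real (Suc (Suc n)) * t) = 2 * cos t * sin (real (Suc n) * t) - sin (real n * t)"
    by (simp add: sin_add sin_diff)
  also have "\<dots> = sin t * poly (cheb (Suc (Suc n))) (2 * cos t)"
    using 3 by (simp add: algebra_simps)
  finally show ?case ..
qed simp_all

lemma cos_pi_ratio_inj:
  assumes "k \<le> N" "k' \<le> N" "N \<ge> 1" "cos (pi * real k / real N) = cos (pi * real k' / real N)"
  shows "k = k'"
proof -
  have "pi * real k / real N = pi * real k' / real N"
    by (rule cos_inj_pi) (use assms in \<open>auto simp: divide_le_eq\<close>)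
  then show ?thesis using assms by simp
qed

text \<open>The N - 1 listed points are distinct zeros by \<open>cheb_sin\<close>, and the degree is
  N - 1.\<close>

lemma cheb_roots:
  assumes "N \<ge> 1"
  shows "{y. poly (cheb N) y = 0} = (\<lambda>k. 2 * cos (pi * real k / real N)) ` {1..<N}"
proof -
  obtain m where m: "N = Suc m" using assms by (cases N) auto
  have d: "degree (cheb N) = m \<and> lead_coeff (cheb N) > 0"
    unfolding m by (rule degree_orth) simp
  then have nz: "cheb N \<noteq> 0" by auto
  have "inj_on (\<lambda>k. 2 * cos (pi * real k / real N)) {1..<N}"
    using cos_pi_ratio_inj[of _ N] assms by (auto intro!: inj_onI)
  then have c: "card ((\<lambda>k. 2 * cos (pi * real k / real N)) ` {1..<N}) = m"
    by (simp add: card_image m)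
  have "(\<lambda>k. 2 * cos (pi * real k / real N)) ` {1..<N} \<subseteq> {y. poly (cheb N) y = 0}"
  proof safe
    fix k assume k: "k \<in> {1..<N}"
    have "real N * (pi * real k / real N) = real k * pi" using k by simp
    then have "sin (pi * real k / real N) * poly (cheb N) (2 * cos (pi * real k / real N)) = 0"
      unfolding cheb_sin by (simp add: sin_npi)
    moreover have "sin (pi * real k / real N) > 0"
      using k by (intro sin_gt_zero) (auto simp: divide_less_eq)
    ultimately show "poly (cheb N) (2 * cos (pi * real k / real N)) = 0" by simp
  qed
  then show ?thesis
    using c card_poly_roots_bound[OF nz] d poly_roots_finite[OF nz]
    by (intro card_subset_eq[symmetric]) (auto intro!: le_antisym card_mono)
qed

section \<open>Transfer matrices and the discriminant\<close>

lemma mat2_mult_assoc: "mat2_mult (mat2_mult A B) C = mat2_mult A (mat2_mult B C)"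
  by (cases A; cases B; cases C) (simp add: mat2_mult_def algebra_simps)

definition mat2_det :: "mat2 \<Rightarrow> real" where
  "mat2_det A = (case A of (a11, a12, a21, a22) \<Rightarrow> a11 * a22 - a12 * a21)"

lemma mat2_det_mult: "mat2_det (mat2_mult A B) = mat2_det A * mat2_det B"
  by (cases A; cases B) (simp add: mat2_mult_def mat2_det_def algebra_simps)

definition mat2_21 :: "mat2 \<Rightarrow> real" where
  "mat2_21 A = (case A of (a11, a12, a21, a22) \<Rightarrow> a21)"

text \<open>Cayley-Hamilton for determinant one, M^2 = (tr M) M - 1, read off in the lower left
  entry after multiplication by \<open>B\<close>.\<close>

lemma mat2_21_cayley:
  assumes "mat2_det M = 1"
  shows "mat2_21 (mat2_mult B (mat2_mult M M)) = mat2_trace M * mat2_21 (mat2_mult B M) - mat2_21 B"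
proof -
  obtain a b c d where M: "M = (a, b, c, d)" by (cases M)
  obtain a' b' c' d' where B: "B = (a', b', c', d')" by (cases B)
  have det: "a * d = 1 + b * c" using assms by (simp add: M mat2_det_def)
  have "c' * (a * a + b * c) + d' * (c * a + d * c) - ((a + d) * (c' * a + d' * c) - c')
    = c' * (1 + b * c - a * d)" by (simp add: algebra_simps)
  then show ?thesis using det by (simp add: M B mat2_mult_def mat2_trace_def mat2_21_def)
qed

locale periodic =
  fixes p :: nat and a b :: "int \<Rightarrow> real"
  assumes per: "periodic_jacobi p a b"
begin

lemma p_pos: "p \<ge> 1" and a_pos [simp]: "a n > 0"
  and a_shift [simp]: "a (n + int p) = a n" and b_shift [simp]: "b (n + int p) = b n"
  using per by (auto simp: periodic_jacobi_def)

lemma a_nz [simp]: "a n \<noteq> 0"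
  using a_pos[of n] by linarith

definition an :: "nat \<Rightarrow> real" where "an n = a (int n)"
definition bn :: "nat \<Rightarrow> real" where "bn n = b (int n)"

sublocale jacobi an bn
  by unfold_locales (simp add: an_def)

lemma a_shift_mult [simp]: "a (n + int p * int k) = a n" and b_shift_mult [simp]: "b (n + int p * int k) = b n"
proof (induction k)
  case (Suc k)
  have e: "n + int p * int (Suc k) = (n + int p * int k) + int p" by (simp add: algebra_simps)
  { case 1 then show ?case unfolding e a_shift using Suc by simp }
  { case 2 then show ?case unfolding e b_shift using Suc by simp }
qed simp_all

lemma bounded_parameters: "\<exists>A. \<forall>n. \<bar>a n\<bar> \<le> A \<and> \<bar>b n\<bar> \<le> A"
proof -
  define A where "A = Max ((\<lambda>n. \<bar>a n\<bar>) ` {0..int p} \<union> (\<lambda>n. \<bar>b n\<bar>) ` {0..int p})"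
  have red: "\<exists>m\<in>{0..int p}. a n = a m \<and> b n = b m" for n
  proof -
    have mods: "0 \<le> n mod int p" "n mod int p \<le> int p"
      using p_pos pos_mod_bound[of "int p" n] by (auto intro: less_imp_le)
    have n: "n = n mod int p + int p * (n div int p)" by (simp add: mult.commute)
    \<comment> \<open>The shift rules cover nonnegative multiples of p only, so the sign of the
      quotient decides whether n or its residue is the shifted index.\<close>
    show ?thesis
    proof (cases "n div int p \<ge> 0")
      case True
      then have "n = n mod int p + int p * int (nat (n div int p))" using n by simp
      then show ?thesis using mods a_shift_mult b_shift_mult by (metis atLeastAtMost_iff)
    next
      case False
      then have "n mod int p = n + int p * int (nat (- (n div int p)))" using n by (simp add: algebra_simps)
      then show ?thesis using mods a_shift_mult b_shift_mult by (metis atLeastAtMost_iff)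
    qed
  qed
  have "\<bar>a n\<bar> \<le> A \<and> \<bar>b n\<bar> \<le> A" for n
  proof -
    obtain m where "m \<in> {0..int p}" "a n = a m" "b n = b m" using red by blast
    then show ?thesis unfolding A_def by (auto intro!: Max_ge)
  qed
  then show ?thesis by blast
qed

lemma transfer_add:
  "transfer a b (n + k * p) x = mat2_mult (transfer a b n x) (transfer a b (k * p) x)"
proof (induction n)
  case 0
  then show ?case by (cases "transfer a b (k * p) x") (simp add: mat2_mult_def)
next
  case (Suc n)
  have "int (Suc n + k * p) = int (Suc n) + int p * int k" by simp
  then have "transfer_step a b (int (Suc n + k * p)) x = transfer_step a b (int (Suc n)) x"
    unfolding transfer_step_def by (simp only: a_shift_mult b_shift_mult)
  then show ?case using Suc by (simp add: mat2_mult_assoc)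
qed

lemma det_transfer: "mat2_det (transfer a b n x) = 1"
proof (induction n)
  case (Suc n)
  have "mat2_det (transfer_step a b (int (Suc n)) x) = 1"
    using a_pos[of "int (Suc n)"] by (simp add: mat2_det_def transfer_step_def power2_eq_square)
  then show ?case using Suc by (simp add: mat2_det_mult)
qed (simp add: mat2_det_def)

text \<open>Each step matrix sends (u_n, a_(n-1) u_(n-1)) to (u_(n+1), a_n u_n); this scaling of the
  second entry is what gives it determinant one.\<close>

lemma transfer_column:
  "fst (transfer a b n x) = poly (u (Suc n)) x \<and> mat2_21 (transfer a b n x) = an n * poly (u n) x"
proof (induction n)
  case 0
  then show ?case by (simp add: mat2_21_def)
next
  case (Suc n)
  obtain a11 a12 a21 a22 where T: "transfer a b n x = (a11, a12, a21, a22)" by (cases "transfer a b n x")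
  have c: "a11 = poly (u (Suc n)) x" "a21 = an n * poly (u n) x"
    using Suc by (auto simp: T mat2_21_def)
  have an: "a (1 + int n) = an (Suc n)" "b (1 + int n) = bn (Suc n)" by (simp_all add: an_def bn_def)
  have "an (Suc n) > 0" using apos by simp
  then show ?case
    unfolding transfer.simps T
    by (simp add: transfer_step_def mat2_mult_def mat2_21_def c an field_simps power2_eq_square)
qed

lemma transfer_poly:
  "\<exists>A B C D. \<forall>x. transfer a b n x = (poly A x, poly B x, poly C x, poly D x)"
proof (induction n)
  case 0
  have "\<forall>x. transfer a b 0 x = (poly 1 x, poly 0 x, poly 0 x, poly 1 x)" by simp
  then show ?case by blast
next
  case (Suc n)
  then obtain A B C D where T: "\<And>x. transfer a b n x = (poly A x, poly B x, poly C x, poly D x)" by blast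
  let ?a = "a (int (Suc n))" and ?l = "[:- b (int (Suc n)), 1:]"
  have "\<forall>x. transfer a b (Suc n) x =
    (poly (smult (1 / ?a) (?l * A - C)) x, poly (smult (1 / ?a) (?l * B - D)) x,
     poly (smult ?a A) x, poly (smult ?a B) x)"
    by (simp add: T transfer_step_def mat2_mult_def algebra_simps power2_eq_square diff_divide_distrib add_divide_distrib)
  then show ?case by blast
qed

definition D :: "real poly" where
  "D = (SOME q. \<forall>x. poly q x = discriminant a b p x)"

lemma poly_D: "poly D x = discriminant a b p x"
proof -
  obtain A B C E where T: "\<And>x. transfer a b p x = (poly A x, poly B x, poly C x, poly E x)"
    using transfer_poly by blast
  have "\<exists>q. \<forall>x. poly q x = discriminant a b p x"
    by (rule exI[of _ "A + E"]) (simp add: discriminant_def T mat2_trace_def)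
  then show ?thesis unfolding D_def by (rule someI2_ex) simp
qed

lemma an_multiple: "an (k * p) = an 0"
  using a_shift_mult[of 0 k] by (simp add: an_def mult.commute)

text \<open>Transfer over N periods is the N-th power of the monodromy matrix, so its lower left
  entries satisfy y_(N+2) = \<open>\<Delta>\<close> y_(N+1) - y_N, the recursion of
  \<open>cheb\<close>. The scale \<open>an (N * p)\<close> is constant by periodicity and
  cancels.\<close>

lemma u_multiple: "poly (u (N * p)) x = poly (u p) x * poly (cheb N) (poly D x)"
proof (induction N rule: orth.induct[of "\<lambda>_ _. _"])
  case (3 a' b' N)
  let ?M = "transfer a b p x"
  have "transfer a b (Suc N * p) x = mat2_mult ?M (transfer a b (N * p) x)"
    using transfer_add[of p N x] by simp
  have comm: "transfer a b (k * p + p) x = mat2_mult (transfer a b (k * p) x) ?M" for k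
    using transfer_add[of "k * p" 1 x] by simp
  have e: "Suc N * p = N * p + p" "Suc (Suc N) * p = Suc N * p + p" by simp_all
  have "mat2_21 (transfer a b (Suc (Suc N) * p) x)
      = mat2_trace ?M * mat2_21 (transfer a b (Suc N * p) x) - mat2_21 (transfer a b (N * p) x)"
    unfolding e(2) comm unfolding e(1) comm mat2_mult_assoc
    by (rule mat2_21_cayley) (rule det_transfer)
  then have "an 0 * poly (u (Suc (Suc N) * p)) x
      = an 0 * (poly D x * poly (u (Suc N * p)) x - poly (u (N * p)) x)"
    unfolding transfer_column[THEN conjunct2] an_multiple poly_D discriminant_def
    by (simp add: algebra_simps)
  moreover have "an 0 \<noteq> 0" by (simp add: an_def)
  ultimately have "poly (u (Suc (Suc N) * p)) x = poly D x * poly (u (Suc N * p)) x - poly (u (N * p)) x"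
    by (simp only: mult_cancel_left) simp
  then show ?case using 3 by (simp add: algebra_simps)
qed simp_all

text \<open>For N = 2 the factorisation reads \<open>u (2 * p) = u p * D\<close>, so 2p - 1 = (p -
  1) + deg D.\<close>

lemma degree_D: "degree D = p"
proof -
  obtain m where m: "p = Suc m" using p_pos by (cases p) auto
  have "poly (u (2 * p)) = poly (u p * D)"
    using u_multiple[of 2] by (simp add: numeral_2_eq_2 fun_eq_iff)
  then have "u (2 * p) = u p * D" by (simp only: poly_eq_poly_eq_iff)
  moreover have "2 * p = Suc (Suc (2 * m))" using m by simp
  ultimately have e: "u (Suc (Suc (2 * m))) = u (Suc m) * D" using m by simp
  then have "D \<noteq> 0" using u_nz[of "Suc (2 * m)"] by auto
  then have "degree (u (Suc (Suc (2 * m)))) = m + degree D"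
    unfolding e by (subst degree_mult_eq) auto
  then show ?thesis unfolding degree_u using m by simp
qed

definition fibre :: "real \<Rightarrow> real set" where
  "fibre c = {x. poly D x = c}"

lemma fibre_finite [simp]: "finite (fibre c)" and card_fibre_le: "card (fibre c) \<le> p"
proof -
  have nz: "D - [:c:] \<noteq> 0" using degree_D p_pos by auto
  have e: "fibre c = {x. poly (D - [:c:]) x = 0}" by (auto simp: fibre_def)
  have "degree (D - [:c:]) \<le> p" by (rule degree_diff_le) (auto simp: degree_D)
  then show "finite (fibre c)" "card (fibre c) \<le> p"
    using card_poly_roots_bound[OF nz] poly_roots_finite[OF nz] by (auto simp: e)
qed

text \<open>The \<open>N p - 1\<close> distinct real zeros of \<open>u (N * p)\<close> are too many for any fibre to have fewer
  than p points.\<close>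

lemma root_partition:
  assumes N: "N \<ge> 1"
  defines "B \<equiv> \<Union>k\<in>{1..<N}. fibre (2 * cos (pi * real k / real N))"
  shows "\<And>k. k \<in> {1..<N} \<Longrightarrow> card (fibre (2 * cos (pi * real k / real N))) = p"
    and "orth_roots an bn (N * p - 1) = orth_roots an bn (p - 1) \<union> B"
    and "orth_roots an bn (p - 1) \<inter> B = {}"
    and "sum h B = (\<Sum>k=1..<N. sum h (fibre (2 * cos (pi * real k / real N))))"
proof -
  let ?c = "\<lambda>k. 2 * cos (pi * real k / real N)"
  have finB: "finite B" by (auto simp: B_def)
  have idx: "Suc (N * p - 1) = N * p" "Suc (p - 1) = p" using N p_pos by auto
  have "poly (cheb N) (poly D x) = 0 \<longleftrightarrow> x \<in> B" for x
    using cheb_roots[OF N] by (auto simp: B_def fibre_def set_eq_iff)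
  then show un: "orth_roots an bn (N * p - 1) = orth_roots an bn (p - 1) \<union> B"
    unfolding orth_roots_def idx using u_multiple[of N] by auto
  have disj: "fibre (?c k) \<inter> fibre (?c k') = {}" if "k \<in> {1..<N}" "k' \<in> {1..<N}" "k \<noteq> k'" for k k'
    using cos_pi_ratio_inj[of k N k'] that N by (auto simp: fibre_def)
  show "sum h B = (\<Sum>k=1..<N. sum h (fibre (?c k)))"
    unfolding B_def by (rule sum.UNION_disjoint) (use disj in auto)
  have cB: "card B = (\<Sum>k=1..<N. card (fibre (?c k)))"
    unfolding B_def by (rule card_UN_disjoint) (use disj in auto)
  have Bsum: "(\<Sum>k=1..<N. card (fibre (?c k))) \<le> (\<Sum>k=1..<N. p)"
    by (intro sum_mono card_fibre_le)
  have "N * p - 1 = card (orth_roots an bn (p - 1) \<union> B)"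
    unfolding un[symmetric] by (rule card_orth_roots[symmetric])
  moreover have "card (orth_roots an bn (p - 1) \<union> B) + card (orth_roots an bn (p - 1) \<inter> B)
     = p - 1 + card B"
    using card_Un_Int[OF finite_orth_roots finB, of "p - 1"] card_orth_roots by simp
  moreover have "(\<Sum>k=1..<N. p) = (N - 1) * p" by simp
  moreover have "N * p - 1 = (N - 1) * p + (p - 1)"
    using N p_pos by (cases N) auto
  ultimately have c0: "card (orth_roots an bn (p - 1) \<inter> B) = 0"
    and ceq: "(\<Sum>k=1..<N. card (fibre (?c k))) = (\<Sum>k=1..<N. p)"
    using Bsum cB by linarith+
  from c0 show "orth_roots an bn (p - 1) \<inter> B = {}" using finB by simp
  show "card (fibre (?c k)) = p" if "k \<in> {1..<N}" for k
    using sum_mono_inv[OF ceq card_fibre_le that] by simp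
qed

text \<open>The half-line cut of the periodic matrix has the period average as limit of its zero
  moments. Along n = N p - 1 the zeros are fibres plus p - 1 fixed points of vanishing share; the
  ratio (N p - 1) / N -> p turns the average into a sum.\<close>

lemma trace_average_tendsto:
  "(\<lambda>N. (1 / real N) * (\<Sum>k=1..<N. \<Sum>x\<in>fibre (2 * cos (pi * real k / real N)). x ^ l))
     \<longlonglongrightarrow> (\<Sum>j=1..p. walk a b l (int j) (int j))"
proof -
  define w where "w i = walk a b l (int i) (int i)" for i
  define Y where "Y N = (\<Sum>k=1..<N. \<Sum>x\<in>fibre (2 * cos (pi * real k / real N)). x ^ l)" for N :: nat
  define c where "c = (1 / real p) * (\<Sum>j=1..p. w j)"
  obtain A where A: "\<And>n. \<bar>a n\<bar> \<le> A" "\<And>n. \<bar>b n\<bar> \<le> A" using bounded_parameters by blast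
  have wp: "w (i + p) = w i" for i
    using walk_shift[of a "int p" b l "int i" "int i"] by (simp add: w_def)
  have avg: "(\<Sum>j=1..p. w (j + n)) = (\<Sum>j=1..p. w j)" for n
  proof (induction n)
    case (Suc n)
    have "(\<Sum>j=1..p. w (j + Suc n)) = (\<Sum>j=Suc 1..Suc p. w (j + n))"
      by (subst sum.shift_bounds_cl_Suc_ivl) simp
    also have "\<dots> + w (1 + n) = (\<Sum>j=1..Suc p. w (j + n))"
      by (subst (2) sum.atLeast_Suc_atMost) auto
    also have "\<dots> = (\<Sum>j=1..p. w (j + n)) + w (Suc p + n)" by simp
    also have "w (Suc p + n) = w (1 + n)" using wp[of "1 + n"] by (simp add: add_ac)
    finally show ?case using Suc by simp
  qed simp
  have "(\<lambda>n. (1 / real p) * (\<Sum>j=1..p. walk (zext an) (zext bn) l (int (j + n)) (int (j + n)))) \<longlonglongrightarrow> c"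
  proof (rule tendsto_eventually)
    show "\<forall>\<^sub>F n in sequentially. (1 / real p) * (\<Sum>j=1..p. walk (zext an) (zext bn) l (int (j + n)) (int (j + n))) = c"
      using eventually_ge_at_top[of l]
    proof eventually_elim
      case (elim n)
      \<comment> \<open>Since n \<ge> l, a walk of l steps from j + n stays at sites \<ge> 1 and
        does not feel the cut.\<close>
      have "walk (zext an) (zext bn) l (int (j + n)) (int (j + n)) = w (j + n)" if "j \<in> {1..p}" for j
        unfolding w_def by (rule walk_cong) (use that elim in \<open>auto simp: zext_def an_def bn_def\<close>)
      then show ?case using avg[of n] by (simp add: c_def)
    qed
  qed
  then have lim: "(\<lambda>n. (1 / real n) * (\<Sum>x\<in>orth_roots an bn n. x ^ l)) \<longlonglongrightarrow> c"
    by (rule root_moments_tendsto[where A = A and B = A, rotated 3]) (use A p_pos in \<open>auto simp: an_def bn_def\<close>)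
  have "filterlim (\<lambda>N. N * p - 1) at_top sequentially"
    unfolding filterlim_at_top
  proof
    fix Z
    show "\<forall>\<^sub>F N in sequentially. Z \<le> N * p - 1"
      using eventually_ge_at_top[of "Suc Z"]
    proof eventually_elim
      case (elim N)
      have "N * 1 \<le> N * p" using p_pos by (intro mult_le_mono2)
      then show ?case using elim by linarith
    qed
  qed
  from filterlim_compose[OF lim this]
  have 1: "(\<lambda>N. (1 / real (N * p - 1)) * (\<Sum>x\<in>orth_roots an bn (N * p - 1). x ^ l)) \<longlonglongrightarrow> c" .
  have 2: "(\<lambda>N. real (N * p - 1) / real N) \<longlonglongrightarrow> real p"
  proof -
    have "(\<lambda>N. real p - 1 / real N) \<longlonglongrightarrow> real p - 0"
      by (intro tendsto_intros lim_const_over_n)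
    moreover have "\<forall>\<^sub>F N in sequentially. real p - 1 / real N = real (N * p - 1) / real N"
      using eventually_gt_at_top[of 0]
    proof eventually_elim
      case (elim N)
      then have "1 \<le> N * p" using p_pos by (simp add: Suc_le_eq)
      then show ?case using elim by (simp add: of_nat_diff field_simps)
    qed
    ultimately show ?thesis by (simp add: Lim_transform_eventually)
  qed
  have 3: "(\<lambda>N. (\<Sum>x\<in>orth_roots an bn (p - 1). x ^ l) / real N) \<longlonglongrightarrow> 0"
    by (rule lim_const_over_n)
  have "(\<lambda>N. (1 / real (N * p - 1)) * (\<Sum>x\<in>orth_roots an bn (N * p - 1). x ^ l) * (real (N * p - 1) / real N)
      - (\<Sum>x\<in>orth_roots an bn (p - 1). x ^ l) / real N) \<longlonglongrightarrow> c * real p - 0"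
    by (intro tendsto_intros 1 2 3)
  moreover have "\<forall>\<^sub>F N in sequentially.
      (1 / real (N * p - 1)) * (\<Sum>x\<in>orth_roots an bn (N * p - 1). x ^ l) * (real (N * p - 1) / real N)
      - (\<Sum>x\<in>orth_roots an bn (p - 1). x ^ l) / real N = (1 / real N) * Y N"
    using eventually_ge_at_top[of 2]
  proof eventually_elim
    case (elim N)
    have N: "N \<ge> 1" using elim by simp
    have "N * 1 \<le> N * p" using p_pos by (intro mult_le_mono2)
    then have nz: "real (N * p - 1) \<noteq> 0" using elim by linarith
    note rp = root_partition[OF N]
    have "(\<Sum>x\<in>orth_roots an bn (N * p - 1). x ^ l) = (\<Sum>x\<in>orth_roots an bn (p - 1). x ^ l) + Y N"
      unfolding rp(2) Y_def rp(4)[symmetric]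
      by (rule sum.union_disjoint) (use rp(3) in auto)
    moreover define M where "M = N * p - 1"
    ultimately show ?case using nz elim unfolding M_def[symmetric] by (simp add: field_simps)
  qed
  ultimately have "(\<lambda>N. (1 / real N) * Y N) \<longlonglongrightarrow> c * real p - 0" by (rule Lim_transform_eventually)
  then show ?thesis using p_pos by (simp add: c_def w_def Y_def)
qed

end

section \<open>Bands of the spectrum\<close>

text \<open>No behaviour at the end points is prescribed beyond boundedness, so the sums are written
  as integrals of step functions and dominated convergence is applied.\<close>

lemma riemann_sum_open_interval:
  fixes f :: "real \<Rightarrow> real"
  assumes cont: "continuous_on {0<..<1} f" and bd: "\<And>t. 0 < t \<Longrightarrow> t < 1 \<Longrightarrow> \<bar>f t\<bar> \<le> K"
  shows "set_integrable lborel {0<..<1} f"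
    and "(\<lambda>N. (1 / real N) * (\<Sum>k=1..<N. f (real k / real N))) \<longlonglongrightarrow> (LINT t:{0<..<1}|lborel. f t)"
proof -
  define f0 where "f0 t = indicator {0<..<1} t *\<^sub>R f t" for t
  define J where "J N k = {(real k - 1) / real N<..real k / real N}" for N k :: nat
  \<comment> \<open>The value at k / N is used on the cell to its left; the last cell, ending at 1,
    is left out and carries 0.\<close>
  define s where "s N t = (\<Sum>k=1..<N. f (real k / real N) * indicator (J N k) t)" for N t
  have Jm [measurable]: "J N k \<in> sets borel" for N k by (simp add: J_def)
  have f0m: "f0 \<in> borel_measurable lborel"
    unfolding f0_def using borel_measurable_continuous_on_indicator[OF _ cont] by simp
  have sm: "s N \<in> borel_measurable lborel" for N unfolding s_def by measurable
  have K0: "0 \<le> K" using bd[of "1/2"] by simp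
  have mem: "k = nat \<lceil>t * real N\<rceil>" if "t \<in> J N k" "k \<in> {1..<N}" for N k t
  proof -
    have "real k - 1 < t * real N" "t * real N \<le> real k"
      using that by (auto simp: J_def field_simps)
    then have "\<lceil>t * real N\<rceil> = int k" by (intro ceiling_unique) auto
    then show ?thesis by simp
  qed
  have s_eq: "s N t = (if nat \<lceil>t * real N\<rceil> \<in> {1..<N} \<and> t \<in> J N (nat \<lceil>t * real N\<rceil>)
      then f (real (nat \<lceil>t * real N\<rceil>) / real N) else 0)" for N t
  proof -
    have "s N t = (\<Sum>k=1..<N. if k = nat \<lceil>t * real N\<rceil> then f (real k / real N) * indicator (J N k) t else 0)"
      unfolding s_def
    proof (intro sum.cong refl)
      fix k assume k: "k \<in> {1..<N}"
      show "f (real k / real N) * indicator (J N k) t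
        = (if k = nat \<lceil>t * real N\<rceil> then f (real k / real N) * indicator (J N k) t else 0)"
      proof (cases "t \<in> J N k")
        case True
        show ?thesis by (simp only: if_P[OF mem[OF True k]])
      next
        case False
        then have "indicator (J N k) t = (0::real)" by simp
        then show ?thesis by (simp only: mult_zero_right if_cancel)
      qed
    qed
    then show ?thesis by (auto split: split_indicator)
  qed
  have J01: "0 < t \<and> t < 1" if "t \<in> J N k" "k \<in> {1..<N}" for N k t
  proof -
    have "0 \<le> (real k - 1) / real N" "real k / real N < 1" using that by (auto simp: divide_less_eq)
    then show ?thesis using that(1) unfolding J_def by auto
  qed
  have sb: "\<bar>s N t\<bar> \<le> K * indicator {0..1} t" for N t
  proof -
    define k where "k = nat \<lceil>t * real N\<rceil>"
    show ?thesis
    proof (cases "k \<in> {1..<N} \<and> t \<in> J N k")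
      case True
      then have "0 < t \<and> t < 1" "0 < real k / real N" "real k / real N < 1"
        using J01[of t N k] by (auto simp: divide_less_eq)
      then show ?thesis using bd[of "real k / real N"] True
        unfolding s_eq k_def[symmetric] by (simp split: split_indicator)
    next
      case False
      then show ?thesis unfolding s_eq k_def[symmetric] using K0 by (auto split: split_indicator)
    qed
  qed
  have lim: "(\<lambda>N. s N t) \<longlonglongrightarrow> f0 t" for t
  proof (cases "0 < t \<and> t < 1")
    case False
    then have "s N t = 0" for N
      unfolding s_eq using J01[of t N "nat \<lceil>t * real N\<rceil>"] by auto
    then show ?thesis using False by (simp add: f0_def)
  next
    case True
    define q where "q N = real (nat \<lceil>t * real N\<rceil>) / real N" for N :: nat
    have q: "t \<le> q N \<and> q N < t + 1 / real N" if "N > 0" for N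
    proof -
      have "0 \<le> t * real N" using True by simp
      then have "t * real N \<le> real (nat \<lceil>t * real N\<rceil>)" "real (nat \<lceil>t * real N\<rceil>) < t * real N + 1"
        by linarith+
      then show ?thesis using that by (auto simp: q_def field_simps)
    qed
    have "q \<longlonglongrightarrow> t"
    proof (rule tendsto_sandwich)
      show "\<forall>\<^sub>F N in sequentially. t \<le> q N"
        by (rule eventually_sequentiallyI[of 1]) (simp add: q)
      show "\<forall>\<^sub>F N in sequentially. q N \<le> t + 1 / real N"
        by (rule eventually_sequentiallyI[of 1]) (simp add: q less_imp_le)
      show "(\<lambda>N. t + 1 / real N) \<longlonglongrightarrow> t"
        using tendsto_add[OF tendsto_const lim_const_over_n[of 1]] by simp
    qed simp
    moreover have "isCont f t"
      using cont True by (simp add: continuous_on_eq_continuous_at)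
    ultimately have "(\<lambda>N. f (q N)) \<longlonglongrightarrow> f t" by (metis isCont_tendsto_compose)
    moreover have "\<forall>\<^sub>F N in sequentially. f (q N) = s N t"
    proof -
      \<comment> \<open>N > 1 / (1 - t) keeps t out of the omitted last cell.\<close>
      obtain N0 :: nat where N0: "1 / (1 - t) < real N0" using reals_Archimedean2 by blast
      show ?thesis using eventually_ge_at_top[of "max 1 N0"]
      proof eventually_elim
        case (elim N)
        define k where "k = nat \<lceil>t * real N\<rceil>"
        have N: "N > 0" "1 / (1 - t) < real N" using elim N0 by auto
        then have tN: "t * real N + 1 < real N" using True by (simp add: divide_less_eq algebra_simps)
        have pos: "0 < t * real N" using True N by simp
        have k: "t * real N \<le> real k" "real k < t * real N + 1" unfolding k_def using pos by linarith+
        have k1: "0 < real k" "real k < real N" using k pos tN by linarith+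
        then have "k \<in> {1..<N}" by auto
        moreover have "t \<in> J N k" using k N by (auto simp: J_def field_simps)
        ultimately show ?case unfolding s_eq q_def k_def[symmetric] by simp
      qed
    qed
    ultimately show ?thesis using True by (simp add: f0_def Lim_transform_eventually)
  qed
  have dom: "integrable lborel (\<lambda>t. K * indicator {0..1::real} t)" by simp
  have dc1: "integrable lborel f0"
    using f0m sm dom by (rule integrable_dominated_convergence[where s = s]) (use lim sb in auto)
  have dc2: "(\<lambda>N. integral\<^sup>L lborel (s N)) \<longlonglongrightarrow> integral\<^sup>L lborel f0"
    using f0m sm dom by (rule integral_dominated_convergence) (use lim sb in auto)
  show "set_integrable lborel {0<..<1} f"
    using dc1 unfolding set_integrable_def f0_def .
  have "integral\<^sup>L lborel (s N) = (1 / real N) * (\<Sum>k=1..<N. f (real k / real N))" for N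
  proof -
    have "integral\<^sup>L lborel (s N) = (\<Sum>k=1..<N. integral\<^sup>L lborel (\<lambda>t. f (real k / real N) * indicator (J N k) t))"
      unfolding s_def by (intro Bochner_Integration.integral_sum integrable_mult_right)
        (auto simp: J_def divide_right_mono intro!: integrable_real_indicator)
    also have "\<dots> = (\<Sum>k=1..<N. f (real k / real N) * (1 / real N))"
    proof (intro sum.cong refl)
      fix k assume "k \<in> {1..<N}"
      have "(real k - 1) / real N \<le> real k / real N" by (simp add: divide_right_mono)
      then have "measure lborel (J N k) = real k / real N - (real k - 1) / real N"
        unfolding J_def by simp
      also have "\<dots> = 1 / real N" by (simp add: diff_divide_distrib)
      finally show "integral\<^sup>L lborel (\<lambda>t. f (real k / real N) * indicator (J N k) t) = f (real k / real N) * (1 / real N)"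
        by simp
    qed
    finally show ?thesis by (simp add: sum_divide_distrib)
  qed
  then show "(\<lambda>N. (1 / real N) * (\<Sum>k=1..<N. f (real k / real N))) \<longlonglongrightarrow> (LINT t:{0<..<1}|lborel. f t)"
    using dc2 unfolding set_lebesgue_integral_def f0_def[symmetric] by simp
qed

text \<open>The input from Jacobi matrices is reduced to the degree of \<open>\<Delta>\<close> and
  to full real fibres at the values 2 cos(\<pi> k / N).\<close>

locale bands =
  fixes p :: nat and D :: "real poly"
  assumes p_pos: "p \<ge> 1" and degree_D: "degree D = p"
    and card_fibre: "\<And>N k. k \<in> {1..<N} \<Longrightarrow> card {x. poly D x = 2 * cos (pi * real k / real N)} = p"
begin

definition crit :: "real set" where "crit = {x. poly (pderiv D) x = 0}"

text \<open>The components of the line without critical points, numbered from the left; counting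
  critical points below x replaces an ordered list of them. Bands with i > q are empty.\<close>

definition band :: "nat \<Rightarrow> real set" where
  "band i = {x. x \<notin> crit \<and> card {y\<in>crit. y < x} = i}"

definition q :: nat where "q = card crit"

lemma finite_crit [simp]: "finite crit" and q_less: "q < p"
proof -
  have nz: "pderiv D \<noteq> 0" using degree_D p_pos by (simp add: pderiv_eq_0_iff)
  show "finite crit" unfolding crit_def by (rule poly_roots_finite[OF nz])
  have "q \<le> degree (pderiv D)" unfolding q_def crit_def by (rule card_poly_roots_bound[OF nz])
  then show "q < p" using degree_D p_pos by (simp add: degree_pderiv)
qed

lemma band_index: "x \<notin> crit \<Longrightarrow> x \<in> band (card {y\<in>crit. y < x}) \<and> card {y\<in>crit. y < x} \<le> q"
  unfolding band_def q_def by (auto intro!: card_mono)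

text \<open>The number of critical points below x is monotone in x, hence constant between two
  points of a band; a critical point in between would raise it.\<close>

lemma is_interval_band: "is_interval (band i)"
  unfolding is_interval_1
proof (intro ballI allI impI)
  fix x z y assume "x \<in> band i" "z \<in> band i" "x \<le> y \<and> y \<le> z"
  then have *: "x \<in> band i" "z \<in> band i" "x \<le> y" "y \<le> z" by auto
  have sub: "{w\<in>crit. w < x} \<subseteq> {w\<in>crit. w < y}" "{w\<in>crit. w < y} \<subseteq> {w\<in>crit. w < z}"
    using * by auto
  have "card {w\<in>crit. w < x} \<le> card {w\<in>crit. w < y}" "card {w\<in>crit. w < y} \<le> card {w\<in>crit. w < z}"
    using sub by (auto intro!: card_mono)
  then have c: "card {w\<in>crit. w < y} = i" using * by (simp add: band_def)
  then have "{w\<in>crit. w < y} = {w\<in>crit. w < z}"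
    using sub * by (intro card_subset_eq) (auto simp: band_def)
  moreover have "y < z" if "y \<in> crit" using that * by (cases "y = z") (auto simp: band_def)
  ultimately have "y \<notin> crit" by blast
  then show "y \<in> band i" using c by (simp add: band_def)
qed

lemma inj_on_band: "inj_on (poly D) (band i)"
proof (rule linorder_inj_onI)
  fix x y assume xy: "x < y" "x \<in> band i" "y \<in> band i"
  show "poly D x \<noteq> poly D y"
  proof
    assume e: "poly D x = poly D y"
    obtain z where z: "x < z" "z < y" "poly D y - poly D x = (y - x) * poly (pderiv D) z"
      using poly_MVT[OF xy(1)] by blast
    then have "z \<in> crit" using e xy by (simp add: crit_def)
    moreover have "z \<in> band i"
      using is_interval_band[of i] xy z unfolding is_interval_1 by (meson less_imp_le)
    ultimately show False by (simp add: band_def)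
  qed
qed (rule linear)

lemma finite_fibre: "finite {x. poly D x = c}"
proof -
  have "D - [:c:] \<noteq> 0" using degree_D p_pos by auto
  from poly_roots_finite[OF this] show ?thesis by (simp add: algebra_simps)
qed

text \<open>Pigeonhole: the p fibre points are not critical, and each of the q + 1 \<le> p bands
  holds at most one of them, so there are p bands and all are hit.\<close>

lemma regular_rational:
  assumes t: "k \<in> {1..<N}" and reg: "\<And>x. x \<in> crit \<Longrightarrow> poly D x \<noteq> 2 * cos (pi * real k / real N)"
  shows "q + 1 = p" and "\<And>i. i \<le> q \<Longrightarrow> \<exists>x\<in>band i. poly D x = 2 * cos (pi * real k / real N)"
proof -
  define Z where "Z = {x. poly D x = 2 * cos (pi * real k / real N)}"
  define ix where "ix x = card {y\<in>crit. y < x}" for x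
  have cZ: "card Z = p" unfolding Z_def by (rule card_fibre[OF t])
  have Zb: "x \<in> band (ix x) \<and> ix x \<le> q" if "x \<in> Z" for x
    using band_index[of x] reg[of x] that by (auto simp: Z_def ix_def)
  have "inj_on ix Z"
  proof (rule inj_onI)
    fix x y assume xy: "x \<in> Z" "y \<in> Z" "ix x = ix y"
    then have "x \<in> band (ix x)" "y \<in> band (ix x)" using Zb by metis+
    then show "x = y" using inj_on_band[of "ix x"] xy by (auto simp: Z_def inj_on_def)
  qed
  then have "card (ix ` Z) = p" using cZ by (simp add: card_image)
  moreover have sub: "ix ` Z \<subseteq> {..q}" using Zb by auto
  moreover have "card (ix ` Z) \<le> card {..q}" using sub by (intro card_mono) auto
  ultimately show qp: "q + 1 = p" using q_less by simp
  then have im: "ix ` Z = {..q}" using sub \<open>card (ix ` Z) = p\<close> by (intro card_subset_eq) auto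
  fix i assume "i \<le> q"
  then obtain x where "x \<in> Z" "i = ix x" using im by (metis atMost_iff imageE)
  then show "\<exists>x\<in>band i. poly D x = 2 * cos (pi * real k / real N)" using Zb[of x] by (auto simp: Z_def)
qed

lemma regular_between:
  fixes s t :: real
  assumes "0 \<le> s" "s < t" "t \<le> 1"
  obtains k N where "k \<in> {1..<N}" "s < real k / real N" "real k / real N < t"
    "\<And>x. x \<in> crit \<Longrightarrow> poly D x \<noteq> 2 * cos (pi * real k / real N)"
proof -
  define T where "T = (\<lambda>x. arccos (poly D x / 2) / pi) ` crit"
  \<comment> \<open>The next angle of a critical value after s, capped at t. Critical values outside
    [-2, 2] contribute unspecified elements of \<open>T\<close>, which merely narrow the
    choice.\<close>
  define t' where "t' = Min (insert t (T \<inter> {s<..}))"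
  have fin: "finite (insert t (T \<inter> {s<..}))" by (simp add: T_def)
  have t': "s < t'" "t' \<le> t" using fin assms by (auto simp: t'_def)
  obtain r where r: "r \<in> \<rat>" "s < r" "r < t'" using Rats_dense_in_real[OF t'(1)] by blast
  obtain k N :: nat where kN: "N \<noteq> 0" "\<bar>r\<bar> = real k / real N" using Rats_abs_nat_div_natE[OF r(1)] by blast
  have r01: "0 < r" "r < 1" using r assms t' by linarith+
  then have rr: "r = real k / real N" "0 < r" "r < 1" using kN by linarith+
  have "0 < real k" using rr kN by (auto simp: zero_less_divide_iff)
  moreover have "real k < real N"
    using rr(3) kN(1) unfolding rr(1) by (subst (asm) divide_less_eq_1_pos) auto
  ultimately have 1: "k \<in> {1..<N}" by auto
  have "r \<notin> T"
  proof
    assume "r \<in> T"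
    then have "t' \<le> r" unfolding t'_def using fin r by (intro Min_le) auto
    then show False using r by simp
  qed
  have 2: "poly D x \<noteq> 2 * cos (pi * real k / real N)" if x: "x \<in> crit" for x
  proof
    assume "poly D x = 2 * cos (pi * real k / real N)"
    then have "arccos (poly D x / 2) / pi = arccos (cos (pi * r)) / pi" by (simp add: rr(1))
    also have "\<dots> = r" using rr(2,3) by (subst arccos_cos) auto
    finally show False using \<open>r \<notin> T\<close> x by (auto simp: T_def)
  qed
  show ?thesis using that[OF 1 _ _ 2] r t' rr by auto
qed

lemma q_eq: "q + 1 = p"
proof -
  obtain k N where "k \<in> {1..<N}" "\<And>x. x \<in> crit \<Longrightarrow> poly D x \<noteq> 2 * cos (pi * real k / real N)"
    using regular_between[of 0 1] by auto
  then show ?thesis by (rule regular_rational(1))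
qed

text \<open>The image of a band is an interval containing regular values on both sides of 2
  cos(\<pi> t). This reaches angles at which no fibre has been counted.\<close>

lemma band_surj:
  assumes t: "0 < t" "t < 1" and i: "i \<le> q"
  shows "2 * cos (pi * t) \<in> poly D ` band i"
proof -
  obtain k N where kN: "k \<in> {1..<N}" "0 < real k / real N" "real k / real N < t"
      "\<And>x. x \<in> crit \<Longrightarrow> poly D x \<noteq> 2 * cos (pi * real k / real N)"
    using regular_between[of 0 t] t by auto
  obtain k' N' where kN': "k' \<in> {1..<N'}" "t < real k' / real N'" "real k' / real N' < 1"
      "\<And>x. x \<in> crit \<Longrightarrow> poly D x \<noteq> 2 * cos (pi * real k' / real N')"
    using regular_between[of t 1] t by auto
  have m: "2 * cos (pi * (real k / real N)) \<in> poly D ` band i" "2 * cos (pi * (real k' / real N')) \<in> poly D ` band i"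
    using regular_rational(2)[OF kN(1,4) i] regular_rational(2)[OF kN'(1,4) i]
    unfolding times_divide_eq_right by (force simp: image_iff)+
  have "is_interval (poly D ` band i)"
    using is_interval_band[of i] unfolding is_interval_connected_1
    by (intro connected_continuous_image) (auto intro: continuous_intros)
  moreover have "cos (pi * t) \<le> cos (pi * (real k / real N))"
    using kN t by (intro cos_monotone_0_pi_le mult_left_mono) (auto simp del: times_divide_eq_right)
  moreover have "cos (pi * (real k' / real N')) \<le> cos (pi * t)"
    using kN' t by (intro cos_monotone_0_pi_le mult_left_mono) (auto simp del: times_divide_eq_right)
  ultimately show ?thesis
    using m mem_is_interval_1_I[of "poly D ` band i" _ _ "2 * cos (pi * t)"] by auto
qed

section \<open>Inverse branches and the density of states\<close>

text \<open>Choosing a homeomorphism rather than a mere inverse builds in continuity, as an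
  injective continuous map on an interval allows.\<close>

definition branch :: "nat \<Rightarrow> real \<Rightarrow> real" where
  "branch i = (SOME g. homeomorphism (band i) (poly D ` band i) (poly D) g)"

lemma homeo_branch: "homeomorphism (band i) (poly D ` band i) (poly D) (branch i)"
proof -
  have "path_connected (band i)"
    using is_interval_band[of i] by (simp add: is_interval_path_connected_1)
  then have "\<exists>g. homeomorphism (band i) (poly D ` band i) (poly D) g"
    by (intro homeomorphism_into_1d inj_on_band) (auto intro: continuous_intros)
  then show ?thesis unfolding branch_def by (rule someI_ex)
qed

lemma branch_in: "0 < t \<Longrightarrow> t < 1 \<Longrightarrow> i \<le> q \<Longrightarrow> branch i (2 * cos (pi * t)) \<in> band i"
  and D_branch: "0 < t \<Longrightarrow> t < 1 \<Longrightarrow> i \<le> q \<Longrightarrow> poly D (branch i (2 * cos (pi * t))) = 2 * cos (pi * t)"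
  using homeo_branch[of i] band_surj[of t i] unfolding homeomorphism_def by auto

lemma branch_D: "x \<in> band i \<Longrightarrow> branch i (poly D x) = x"
  using homeo_branch[of i] unfolding homeomorphism_def by auto

lemma bounded_spectrum: "\<exists>R. \<forall>x. \<bar>poly D x\<bar> \<le> 2 \<longrightarrow> \<bar>x\<bar> \<le> R"
proof -
  obtain d D' where D: "D = pCons d D'" by (cases D)
  then have "D' \<noteq> 0" using degree_D p_pos by auto
  from poly_infinity[OF this, of 3 d] obtain r where "\<forall>z. r \<le> norm z \<longrightarrow> 3 \<le> norm (poly D z)"
    unfolding D by blast
  then have r: "3 \<le> \<bar>poly D x\<bar>" if "r \<le> \<bar>x\<bar>" for x using that by simp
  have "\<bar>x\<bar> \<le> r" if "\<bar>poly D x\<bar> \<le> 2" for x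
    using that r[of x] by linarith
  then show ?thesis by blast
qed

text \<open>The q + 1 = p branches give distinct points, one per band, and the fibre has p
  points.\<close>

lemma fibre_sum:
  assumes k: "k \<in> {1..<N}"
  shows "(\<Sum>x | poly D x = 2 * cos (pi * real k / real N). h x)
     = (\<Sum>i\<le>q. h (branch i (2 * cos (pi * (real k / real N)))))"
proof -
  define t where "t = real k / real N"
  have t: "0 < t" "t < 1" using k by (auto simp: t_def)
  define g where "g i = branch i (2 * cos (pi * t))" for i
  have gb: "g i \<in> band i" "poly D (g i) = 2 * cos (pi * t)" if "i \<le> q" for i
    using branch_in[OF t that] D_branch[OF t that] by (auto simp: g_def)
  have inj: "inj_on g {..q}"
  proof (rule inj_onI)
    fix i j assume "i \<in> {..q}" "j \<in> {..q}" "g i = g j"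
    then have "g i \<in> band i" "g i \<in> band j" using gb by (metis atMost_iff)+
    then show "i = j" by (simp add: band_def)
  qed
  have "g ` {..q} = {x. poly D x = 2 * cos (pi * t)}"
  proof (rule card_subset_eq[OF finite_fibre])
    show "card (g ` {..q}) = card {x. poly D x = 2 * cos (pi * t)}"
      using card_fibre[OF k] q_eq inj by (simp add: card_image t_def)
  qed (use gb in auto)
  then have "(\<Sum>x | poly D x = 2 * cos (pi * t). h x) = (\<Sum>i\<le>q. h (g i))"
    using sum.reindex[OF inj, of h] by simp
  then show ?thesis by (simp add: t_def g_def)
qed

text \<open>The modulus of the derivative of arccos(\<open>\<Delta>\<close> / 2) / \<pi>; it gives
  each of the p open bands mass one.\<close>

definition weight :: "real \<Rightarrow> real" where
  "weight x = \<bar>poly (pderiv D) x\<bar> / (pi * sqrt (4 - (poly D x)\<^sup>2))"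

definition dos :: "real measure" where
  "dos = density lborel (\<lambda>x. ennreal (indicator {x. \<bar>poly D x\<bar> \<le> 2} x *
      ((2 / real p) * \<bar>poly (pderiv D) x\<bar> / sqrt (4 - (poly D x)\<^sup>2) / (2 * pi))))"

definition open_band :: "nat \<Rightarrow> real set" where "open_band i = {x\<in>band i. \<bar>poly D x\<bar> < 2}"

lemma measurable_D [measurable]: "poly q \<in> borel_measurable borel" for q :: "real poly"
  by (intro borel_measurable_continuous_onI continuous_intros)

lemma D_sq_le: "x \<in> open_band i \<Longrightarrow> (poly D x)\<^sup>2 \<le> 4"
  using abs_le_square_iff[of "poly D x" 2] by (simp add: open_band_def)

lemma open_band_borel [measurable]: "open_band i \<in> sets borel"
proof -
  have [measurable]: "band i \<in> sets borel" by (rule real_interval_borel_measurable[OF is_interval_band])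
  have "open_band i = band i \<inter> {x\<in>space borel. \<bar>poly D x\<bar> < 2}" by (auto simp: open_band_def)
  also have "\<dots> \<in> sets borel" by measurable
  finally show ?thesis .
qed

lemma weight_measurable [measurable]: "weight \<in> borel_measurable borel"
  unfolding weight_def by measurable

text \<open>The identity holds at every point: where |\<open>\<Delta>\<close>| = 2 the quotient is a
  division by 0 and so equals 0, and at critical points its numerator vanishes.\<close>

lemma dos_density_eq:
  "indicator {x. \<bar>poly D x\<bar> \<le> 2} x * ((2 / real p) * \<bar>poly (pderiv D) x\<bar> / sqrt (4 - (poly D x)\<^sup>2) / (2 * pi))
    = (1 / real p) * (\<Sum>i\<le>q. indicator (open_band i) x * weight x)"
proof (cases "\<bar>poly D x\<bar> < 2 \<and> x \<notin> crit")
  case True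
  define j where "j = card {y\<in>crit. y < x}"
  have j: "j \<le> q" using band_index[of x] True by (simp add: j_def)
  have "indicator (open_band i) x = (if i = j then 1 else 0 :: real)" for i
    using True by (auto simp: open_band_def band_def j_def)
  then have "(\<Sum>i\<le>q. indicator (open_band i) x * weight x) = (\<Sum>i\<le>q. if i = j then weight x else 0)"
    by (intro sum.cong) auto
  also have "\<dots> = weight x" using j by simp
  finally show ?thesis using True by (simp add: weight_def)
next
  case False
  have 1: "(\<Sum>i\<le>q. indicator (open_band i) x * weight x) = 0"
    using False by (intro sum.neutral) (auto simp: open_band_def band_def)
  have "\<bar>poly D x\<bar> > 2 \<or> \<bar>poly D x\<bar> = 2 \<or> poly (pderiv D) x = 0"
    using False by (auto simp: crit_def)
  then show ?thesis
  proof (elim disjE)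
    assume "\<bar>poly D x\<bar> = 2"
    then have "(poly D x)\<^sup>2 = 2\<^sup>2" by (metis power2_abs)
    then show ?thesis using 1 by simp
  qed (use 1 in auto)
qed

text \<open>The substitution t = \<open>\<phi> x\<close> maps the open band onto (0, 1) with
  |\<phi>'| = \<open>weight\<close>, so the integral becomes that of \<open>f\<close>, a limit of
  Riemann sums.\<close>

lemma band_integral:
  fixes h :: "real \<Rightarrow> real"
  assumes i: "i \<le> q" and h: "continuous_on UNIV h"
  shows "integrable lborel (\<lambda>x. indicator (open_band i) x * weight x * h x)"
    and "(\<lambda>N. (1 / real N) * (\<Sum>k=1..<N. h (branch i (2 * cos (pi * (real k / real N)))))) \<longlonglongrightarrow>
       (\<integral>x. indicator (open_band i) x * weight x * h x \<partial>lborel)"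
proof -
  define f where "f t = h (branch i (2 * cos (pi * t)))" for t
  have hm [measurable]: "h \<in> borel_measurable borel" by (rule borel_measurable_continuous_onI[OF h])
  have cf: "continuous_on {0<..<1} f"
    unfolding f_def
  proof (rule continuous_on_compose2[OF h])
    have "continuous_on (poly D ` band i) (branch i)"
      using homeo_branch[of i] by (simp add: homeomorphism_def)
    then show "continuous_on {0<..<1} (\<lambda>t. branch i (2 * cos (pi * t)))"
      by (rule continuous_on_compose2) (use band_surj i in \<open>auto intro!: continuous_intros\<close>)
  qed auto
  \<comment> \<open>\<open>h\<close> is only continuous; its bound comes from a compact interval
    containing the spectrum, where all branch values lie.\<close>
  obtain R where R: "\<And>x. \<bar>poly D x\<bar> \<le> 2 \<Longrightarrow> \<bar>x\<bar> \<le> R" using bounded_spectrum by blast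
  have "compact (h ` {-R..R})"
    by (intro compact_continuous_image continuous_on_subset[OF h]) auto
  from compact_imp_bounded[OF this] obtain K where "\<forall>y\<in>h ` {-R..R}. norm y \<le> K"
    unfolding bounded_iff by blast
  then have K: "\<And>x. x \<in> {-R..R} \<Longrightarrow> \<bar>h x\<bar> \<le> K" by auto
  have bf: "\<bar>f t\<bar> \<le> K" if "0 < t" "t < 1" for t
  proof -
    have "\<bar>poly D (branch i (2 * cos (pi * t)))\<bar> \<le> 2" unfolding D_branch[OF that i] by (simp add: abs_mult)
    from R[OF this] show ?thesis unfolding f_def by (intro K) auto
  qed
  note rs = riemann_sum_open_interval[OF cf bf]
  define \<phi> where "\<phi> x = arccos (poly D x / 2) / pi" for x
  define \<phi>' where "\<phi>' x = poly (pderiv D) x / 2 * inverse (- sqrt (1 - (poly D x / 2)\<^sup>2)) / pi" for x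
  have lt: "\<bar>poly D x / 2\<bar> < 1" if "x \<in> open_band i" for x using that by (auto simp: open_band_def)
  have der: "(\<phi> has_field_derivative \<phi>' x) (at x within open_band i)" if "x \<in> open_band i" for x
    unfolding \<phi>_def \<phi>'_def using lt[OF that]
    by (auto intro!: derivative_eq_intros simp: abs_less_iff)
  have cosphi: "2 * cos (pi * \<phi> x) = poly D x" if "x \<in> open_band i" for x
    using lt[OF that] by (simp add: \<phi>_def abs_less_iff)
  have inj: "inj_on \<phi> (open_band i)"
  proof (rule inj_onI)
    fix x y assume xy: "x \<in> open_band i" "y \<in> open_band i" "\<phi> x = \<phi> y"
    then have "poly D x = poly D y" using cosphi by metis
    then show "x = y" using inj_on_band[of i] xy by (auto simp: open_band_def inj_on_def)
  qed
  have img: "\<phi> ` open_band i = {0<..<1}"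
  proof (intro equalityI subsetI)
    fix t assume "t \<in> \<phi> ` open_band i"
    then obtain x where x: "x \<in> open_band i" "t = \<phi> x" by auto
    have "-1 < poly D x / 2" "poly D x / 2 < 1" using lt[OF x(1)] by (auto simp: abs_less_iff)
    from arccos_lt_bounded[OF this] show "t \<in> {0<..<1}" by (simp add: x(2) \<phi>_def divide_less_eq)
  next
    fix t :: real assume t: "t \<in> {0<..<1}"
    define x where "x = branch i (2 * cos (pi * t))"
    have x: "x \<in> band i" "poly D x = 2 * cos (pi * t)" using t branch_in D_branch i by (auto simp: x_def)
    have "\<bar>cos (pi * t)\<bar> < 1"
    proof -
      have "sin (pi * t) > 0" using t by (intro sin_gt_zero) auto
      then have "(cos (pi * t))\<^sup>2 < 1" using sin_cos_squared_add[of "pi * t"] zero_less_power[of "sin (pi * t)" 2] by linarith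
      then show ?thesis by (simp add: abs_square_less_1)
    qed
    then have "x \<in> open_band i" using x by (simp add: open_band_def abs_mult)
    moreover have "\<phi> x = t" using t by (simp add: \<phi>_def x arccos_cos)
    ultimately show "t \<in> \<phi> ` open_band i" by force
  qed
  have w: "\<bar>\<phi>' x\<bar> = weight x" if "x \<in> open_band i" for x
  proof -
    have "4 - (poly D x)\<^sup>2 = 2\<^sup>2 * (1 - (poly D x / 2)\<^sup>2)" by (simp add: power_divide)
    then have "sqrt (4 - (poly D x)\<^sup>2) = 2 * sqrt (1 - (poly D x / 2)\<^sup>2)"
      by (simp only: real_sqrt_mult real_sqrt_abs)
    then have "sqrt (1 - (poly D x / 2)\<^sup>2) = sqrt (4 - (poly D x)\<^sup>2) / 2" by simp
    moreover have "0 \<le> sqrt (4 - (poly D x)\<^sup>2)"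
      using D_sq_le[OF that] by simp
    ultimately show ?thesis by (simp add: \<phi>'_def weight_def abs_mult abs_divide field_simps)
  qed
  have fphi: "f (\<phi> x) = h x" if "x \<in> open_band i" for x
    using that unfolding f_def cosphi[OF that] by (subst branch_D) (auto simp: open_band_def)
  have abs01: "f absolutely_integrable_on {0<..<1}"
  proof -
    have "(\<lambda>t. indicator {0<..<1} t *\<^sub>R f t) \<in> borel_measurable lborel"
      using rs(1) unfolding set_integrable_def by (rule borel_measurable_integrable)
    then show ?thesis using rs(1) unfolding set_integrable_def by (simp add: integrable_completion)
  qed
  have obl: "open_band i \<in> sets lebesgue" using open_band_borel[of i] by simp
  from has_absolute_integral_change_of_variables_1'[OF obl der inj, of f "integral {0<..<1} f"]
  have cv: "(\<lambda>x. \<bar>\<phi>' x\<bar> * f (\<phi> x)) absolutely_integrable_on open_band i"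
      "integral (open_band i) (\<lambda>x. \<bar>\<phi>' x\<bar> * f (\<phi> x)) = integral {0<..<1} f"
    using abs01 unfolding img by auto
  have "(\<lambda>x. indicator (open_band i) x *\<^sub>R (\<bar>\<phi>' x\<bar> * f (\<phi> x))) = (\<lambda>x. indicator (open_band i) x * weight x * h x)"
    using w fphi by (auto simp: fun_eq_iff split: split_indicator)
  then have il: "integrable lebesgue (\<lambda>x. indicator (open_band i) x * weight x * h x)"
    using cv(1) unfolding set_integrable_def by simp
  have meas: "(\<lambda>x. indicator (open_band i) x * weight x * h x) \<in> borel_measurable lborel" by measurable
  then show int: "integrable lborel (\<lambda>x. indicator (open_band i) x * weight x * h x)"
    using il by (simp add: integrable_completion)
  have "set_integrable lborel (open_band i) (\<lambda>x. weight x * h x)"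
    using int unfolding set_integrable_def by (simp add: mult.assoc)
  then have "(LINT x:open_band i|lborel. weight x * h x) = integral (open_band i) (\<lambda>x. weight x * h x)"
    by (rule set_borel_integral_eq_integral(2))
  also have "\<dots> = integral (open_band i) (\<lambda>x. \<bar>\<phi>' x\<bar> * f (\<phi> x))"
    by (intro integral_cong) (simp add: w fphi)
  also have "\<dots> = (LINT t:{0<..<1}|lborel. f t)"
    unfolding cv(2) by (rule set_borel_integral_eq_integral(2)[OF rs(1), symmetric])
  finally have "(\<integral>x. indicator (open_band i) x * weight x * h x \<partial>lborel) = (LINT t:{0<..<1}|lborel. f t)"
    by (simp add: set_lebesgue_integral_def mult.assoc)
  then show "(\<lambda>N. (1 / real N) * (\<Sum>k=1..<N. h (branch i (2 * cos (pi * (real k / real N)))))) \<longlonglongrightarrow>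
       (\<integral>x. indicator (open_band i) x * weight x * h x \<partial>lborel)"
    using rs(2) by (simp only: f_def)
qed

text \<open>Sums over branches regroup into sums over fibres; the factor p undoes the normalisation
  of \<open>dos\<close>.\<close>

lemma dos_integral:
  fixes h :: "real \<Rightarrow> real"
  assumes h: "continuous_on UNIV h"
  shows "integrable dos h"
    and "(\<lambda>N. (1 / real N) * (\<Sum>k=1..<N. \<Sum>x | poly D x = 2 * cos (pi * real k / real N). h x))
      \<longlonglongrightarrow> real p * (\<integral>x. h x \<partial>dos)"
proof -
  have hm [measurable]: "h \<in> borel_measurable borel" by (rule borel_measurable_continuous_onI[OF h])
  define g where "g x = (1 / real p) * (\<Sum>i\<le>q. indicator (open_band i) x * weight x)" for x
  have gm [measurable]: "g \<in> borel_measurable borel" unfolding g_def by measurable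
  have dos: "dos = density lborel (\<lambda>x. ennreal (g x))"
    unfolding dos_def dos_density_eq g_def ..
  have wn: "0 \<le> indicator (open_band i) x * weight x" for i x
  proof (cases "x \<in> open_band i")
    case True
    then show ?thesis using D_sq_le[OF True] by (simp add: weight_def)
  qed simp
  have gn: "0 \<le> g x" for x unfolding g_def by (intro mult_nonneg_nonneg sum_nonneg wn) auto
  have gh: "g x * h x = (1 / real p) * (\<Sum>i\<le>q. indicator (open_band i) x * weight x * h x)" for x
    by (simp only: g_def sum_distrib_right mult.assoc)
  have int: "integrable lborel (\<lambda>x. g x * h x)"
    unfolding gh by (intro integrable_mult_right Bochner_Integration.integrable_sum band_integral(1) h) auto
  show "integrable dos h" unfolding dos using int gn by (subst integrable_density) auto
  have "(\<integral>x. h x \<partial>dos) = (\<integral>x. g x * h x \<partial>lborel)"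
    unfolding dos using gn by (subst integral_density) auto
  also have "\<dots> = (1 / real p) * (\<Sum>i\<le>q. \<integral>x. indicator (open_band i) x * weight x * h x \<partial>lborel)"
    unfolding gh by (subst Bochner_Integration.integral_sum[symmetric])
      (auto intro!: band_integral(1) h)
  finally have v: "real p * (\<integral>x. h x \<partial>dos) = (\<Sum>i\<le>q. \<integral>x. indicator (open_band i) x * weight x * h x \<partial>lborel)"
    using p_pos by simp
  have "(\<lambda>N. \<Sum>i\<le>q. (1 / real N) * (\<Sum>k=1..<N. h (branch i (2 * cos (pi * (real k / real N)))))) \<longlonglongrightarrow>
      real p * (\<integral>x. h x \<partial>dos)"
    unfolding v by (intro tendsto_sum band_integral(2) h) auto
  moreover have "(\<Sum>i\<le>q. (1 / real N) * (\<Sum>k=1..<N. h (branch i (2 * cos (pi * (real k / real N))))))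
     = (1 / real N) * (\<Sum>k=1..<N. \<Sum>x | poly D x = 2 * cos (pi * real k / real N). h x)" for N
    unfolding sum_distrib_left[symmetric] by (subst sum.swap) (simp add: fibre_sum)
  ultimately show "(\<lambda>N. (1 / real N) * (\<Sum>k=1..<N. \<Sum>x | poly D x = 2 * cos (pi * real k / real N). h x))
      \<longlonglongrightarrow> real p * (\<integral>x. h x \<partial>dos)" by simp
qed

lemma AE_dos: "AE x in dos. \<bar>poly D x\<bar> \<le> 2"
  unfolding dos_def by (subst AE_density) (auto split: split_indicator)

end

section \<open>Weak convergence from moments\<close>

text \<open>Common interface to weighted integrals and zero averages: linearity on polynomials and a
  Lipschitz bound in the sup norm over [-C, C] are what Weierstrass approximation uses.\<close>

definition sup_bounded_functional :: "real \<Rightarrow> real \<Rightarrow> ((real \<Rightarrow> real) \<Rightarrow> real) \<Rightarrow> bool" where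
  "sup_bounded_functional C M L \<longleftrightarrow>
     (\<forall>m c. L (\<lambda>x. \<Sum>k\<le>m. c k * x ^ k) = (\<Sum>k\<le>m. c k * L (\<lambda>x. x ^ k))) \<and>
     (\<forall>f g e. continuous_on UNIV f \<longrightarrow> continuous_on UNIV g \<longrightarrow>
        (\<forall>x. \<bar>x\<bar> \<le> C \<longrightarrow> \<bar>f x - g x\<bar> \<le> e) \<longrightarrow> \<bar>L f - L g\<bar> \<le> M * e)"

lemma moments_imp_weak:
  assumes L: "\<And>n. sup_bounded_functional C M (L n)" and L': "sup_bounded_functional C M' L'"
    and M: "M \<ge> 0" "M' \<ge> 0"
    and mom: "\<And>l. (\<lambda>n. L n (\<lambda>x. x ^ l)) \<longlonglongrightarrow> L' (\<lambda>x. x ^ l)"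
    and f: "continuous_on UNIV f"
  shows "(\<lambda>n. L n f) \<longlonglongrightarrow> L' f"
proof (rule LIMSEQ_I)
  fix r :: real assume r: "r > 0"
  \<comment> \<open>The summand 1 keeps the denominator positive and makes
    \<open>(M + M') * e < r / 2\<close> strict.\<close>
  define e where "e = r / (2 * (M + M' + 1))"
  have e: "e > 0" "(M + M') * e < r / 2" using r M by (auto simp: e_def field_simps)
  obtain g where g: "real_polynomial_function g" "\<And>x. x \<in> {-C..C} \<Longrightarrow> \<bar>f x - g x\<bar> < e"
    using Stone_Weierstrass_real_polynomial_function[of "{-C..C}" f e] f e
    by (metis compact_Icc continuous_on_subset subset_UNIV)
  obtain c m where gc: "g = (\<lambda>x. \<Sum>k\<le>m. c k * x ^ k)"
    using g(1) unfolding real_polynomial_function_iff_sum by blast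
  have gcont: "continuous_on UNIV g" unfolding gc by (intro continuous_intros)
  have close: "\<forall>x. \<bar>x\<bar> \<le> C \<longrightarrow> \<bar>f x - g x\<bar> \<le> e" 
  proof (intro allI impI)
    fix x assume "\<bar>x\<bar> \<le> C"
    then have "x \<in> {-C..C}" by auto
    from g(2)[OF this] show "\<bar>f x - g x\<bar> \<le> e" by simp
  qed
  have 1: "\<bar>L n f - L n g\<bar> \<le> M * e" for n
    using L[of n] f gcont close unfolding sup_bounded_functional_def by blast
  have 2: "\<bar>L' f - L' g\<bar> \<le> M' * e"
    using L' f gcont close unfolding sup_bounded_functional_def by blast
  have "L n g = (\<Sum>k\<le>m. c k * L n (\<lambda>x. x ^ k))" for n
    unfolding gc using L[of n] unfolding sup_bounded_functional_def by blast
  moreover have "L' g = (\<Sum>k\<le>m. c k * L' (\<lambda>x. x ^ k))"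
    unfolding gc using L' unfolding sup_bounded_functional_def by blast
  moreover have "(\<lambda>n. \<Sum>k\<le>m. c k * L n (\<lambda>x. x ^ k)) \<longlonglongrightarrow> (\<Sum>k\<le>m. c k * L' (\<lambda>x. x ^ k))"
    by (intro tendsto_sum tendsto_mult_left mom)
  ultimately have "(\<lambda>n. L n g) \<longlonglongrightarrow> L' g" by simp
  from LIMSEQ_D[OF this, of "r / 2"] r obtain n0
    where n0: "\<And>n. n \<ge> n0 \<Longrightarrow> \<bar>L n g - L' g\<bar> < r / 2" by auto
  have "norm (L n f - L' f) < r" if "n \<ge> n0" for n
    using 1[of n] 2 n0[OF that] e(2) unfolding real_norm_def distrib_right by linarith
  then show "\<exists>no. \<forall>n\<ge>no. norm (L n f - L' f) < r" by blast
qed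

text \<open>A continuous function is bounded on [-C, C], which carries all the mass; the Lipschitz
  constant is the total weight.\<close>

lemma sup_bounded_functional_integral:
  fixes w :: "real \<Rightarrow> real"
  assumes N: "sets N = sets borel" and w: "integrable N w" "\<And>x. 0 \<le> w x"
    and C: "AE x in N. \<bar>x\<bar> \<le> C"
  shows "sup_bounded_functional C (\<integral>x. w x \<partial>N) (\<lambda>f. \<integral>x. f x * w x \<partial>N)"
  unfolding sup_bounded_functional_def
proof (intro conjI allI impI)
  have int: "integrable N (\<lambda>x. f x * w x)" if f: "continuous_on UNIV f" for f
  proof -
    have [measurable]: "f \<in> borel_measurable N"
      unfolding measurable_cong_sets[OF N refl] by (rule borel_measurable_continuous_onI[OF f])
    have [measurable]: "w \<in> borel_measurable N" using w(1) by simp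
    have "compact (f ` {-C..C})" by (intro compact_continuous_image continuous_on_subset[OF f]) auto
    from compact_imp_bounded[OF this] obtain K where "\<forall>y\<in>f ` {-C..C}. norm y \<le> K"
      unfolding bounded_iff by blast
    then have K: "\<bar>f x\<bar> \<le> K" if "\<bar>x\<bar> \<le> C" for x using that by (auto simp: abs_le_iff)
    show ?thesis
    proof (rule Bochner_Integration.integrable_bound)
      show "integrable N (\<lambda>x. K * w x)" using w by simp
      show "AE x in N. norm (f x * w x) \<le> norm (K * w x)"
        using C
      proof eventually_elim
        case (elim x)
        show ?case using K[OF elim] w(2)[of x] by (auto simp: abs_mult intro: mult_right_mono)
      qed
    qed measurable
  qed
  {
    fix m :: nat and c :: "nat \<Rightarrow> real"
    have "integrable N (\<lambda>x. c k * (x ^ k * w x))" for k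
      by (intro integrable_mult_right int continuous_intros)
    then show "(\<integral>x. (\<Sum>k\<le>m. c k * x ^ k) * w x \<partial>N) = (\<Sum>k\<le>m. c k * (\<integral>x. x ^ k * w x \<partial>N))"
      by (simp add: sum_distrib_right mult.assoc)
  next
    fix f g :: "real \<Rightarrow> real" and e
    assume fg: "continuous_on UNIV f" "continuous_on UNIV g"
      and e: "\<forall>x. \<bar>x\<bar> \<le> C \<longrightarrow> \<bar>f x - g x\<bar> \<le> e"
    have "(\<integral>x. f x * w x \<partial>N) - (\<integral>x. g x * w x \<partial>N) = (\<integral>x. (f x - g x) * w x \<partial>N)"
      using int[OF fg(1)] int[OF fg(2)] by (simp add: left_diff_distrib)
    also have "\<bar>\<dots>\<bar> \<le> (\<integral>x. \<bar>(f x - g x) * w x\<bar> \<partial>N)" by (rule integral_abs_bound)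
    also have "\<dots> \<le> (\<integral>x. e * w x \<partial>N)"
    proof (rule integral_mono_AE)
      show "AE x in N. \<bar>(f x - g x) * w x\<bar> \<le> e * w x"
        using C
      proof eventually_elim
        case (elim x)
        then show ?case using e w(2)[of x] by (auto simp: abs_mult intro: mult_right_mono)
      qed
      show "integrable N (\<lambda>x. \<bar>(f x - g x) * w x\<bar>)"
        by (intro integrable_abs int continuous_intros fg)
    qed (use w in simp)
    finally show "\<bar>(\<integral>x. f x * w x \<partial>N) - (\<integral>x. g x * w x \<partial>N)\<bar> \<le> (\<integral>x. w x \<partial>N) * e"
      by (simp add: mult.commute)
  }
qed

lemma sup_bounded_functional_average:
  assumes Z: "card Z \<le> n" "\<And>x. x \<in> Z \<Longrightarrow> \<bar>x\<bar> \<le> C" and C: "C \<ge> 0"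
  shows "sup_bounded_functional C 1 (\<lambda>f. (1 / real n) * (\<Sum>x\<in>Z. f x))"
  unfolding sup_bounded_functional_def
proof (intro conjI allI impI)
  fix m :: nat and c :: "nat \<Rightarrow> real"
  show "(1 / real n) * (\<Sum>x\<in>Z. \<Sum>k\<le>m. c k * x ^ k) = (\<Sum>k\<le>m. c k * ((1 / real n) * (\<Sum>x\<in>Z. x ^ k)))"
    by (subst sum.swap) (simp add: sum_distrib_left mult.left_commute)
next
  fix f g :: "real \<Rightarrow> real" and e
  assume e: "\<forall>x. \<bar>x\<bar> \<le> C \<longrightarrow> \<bar>f x - g x\<bar> \<le> e"
  then have "0 \<le> e" using C abs_ge_zero[of "f 0 - g 0"] by (metis abs_zero order_trans)
  have "\<bar>(\<Sum>x\<in>Z. f x) - (\<Sum>x\<in>Z. g x)\<bar> \<le> (\<Sum>x\<in>Z. \<bar>f x - g x\<bar>)"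
    unfolding sum_subtractf[symmetric] by (rule sum_abs)
  also have "\<dots> \<le> (\<Sum>x\<in>Z. e)" using e Z(2) by (intro sum_mono) auto
  also have "\<dots> \<le> real n * e" using Z(1) \<open>0 \<le> e\<close> by (simp add: mult_right_mono)
  finally have *: "\<bar>(\<Sum>x\<in>Z. f x) - (\<Sum>x\<in>Z. g x)\<bar> \<le> real n * e" .
  show "\<bar>(1 / real n) * (\<Sum>x\<in>Z. f x) - (1 / real n) * (\<Sum>x\<in>Z. g x)\<bar> \<le> 1 * e"
  proof (cases "n = 0")
    case True
    then show ?thesis using \<open>0 \<le> e\<close> by simp
  next
    case False
    then show ?thesis using *
      by (simp add: right_diff_distrib[symmetric] diff_divide_distrib[symmetric] abs_mult divide_le_eq mult.commute)
  qed
qed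

section \<open>Convergence of the windowed moments\<close>

context periodic
begin

sublocale bd: bands p D
proof
  fix N k :: nat assume k: "k \<in> {1..<N}"
  then have "N \<ge> 1" by auto
  from root_partition(1)[OF this k] show "card {x. poly D x = 2 * cos (pi * real k / real N)} = p"
    by (simp add: fibre_def)
qed (rule p_pos degree_D)+

lemma dos_measure_eq: "dos_measure p a b = bd.dos"
proof -
  have e: "discriminant a b p = poly D" by (simp add: fun_eq_iff poly_D)
  have "deriv (poly D) x = poly (pderiv D) x" for x by (rule DERIV_imp_deriv[OF poly_DERIV])
  then show ?thesis unfolding dos_measure_def bd.dos_def periodic_spectrum_def e by simp
qed

text \<open>The sum over a period and p times the integral are limits of the same averages over
  fibres.\<close>

lemma trace_formula:
  "(1 / real p) * (\<Sum>j=1..p. walk a b l (int j) (int j)) = (\<integral>x. x ^ l \<partial>dos_measure p a b)"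
proof -
  have "(\<Sum>j=1..p. walk a b l (int j) (int j)) = real p * (\<integral>x. x ^ l \<partial>bd.dos)"
    by (rule LIMSEQ_unique[OF trace_average_tendsto bd.dos_integral(2)[of "\<lambda>x. x ^ l", folded fibre_def]])
       (intro continuous_intros)
  then show ?thesis using p_pos by (simp add: dos_measure_eq)
qed

end

section \<open>Compactness and right limits\<close>

text \<open>Tychonoff for a product of intervals; with countably many coordinates, compactness of
  the product yields convergent subsequences.\<close>

lemma coordinatewise_convergent_subsequence:
  fixes f :: "nat \<Rightarrow> 'i::countable \<Rightarrow> real"
  assumes "\<And>j k. \<bar>f j k\<bar> \<le> A"
  obtains s g where "strict_mono s" "\<And>k. (\<lambda>j. f (s j) k) \<longlonglongrightarrow> g k"
proof -
  define S :: "('i \<Rightarrow> real) set" where "S = PiE UNIV (\<lambda>_. {-A..A})"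
  have "compactin (product_topology (\<lambda>_. euclidean) UNIV) S"
    unfolding S_def by (subst compactin_PiE) auto
  then have "compact S" by (simp add: euclidean_product_topology)
  then have "seq_compact S" by (rule compact_imp_seq_compact)
  moreover have "\<forall>j. f j \<in> S" using assms by (auto simp: S_def abs_le_iff minus_le_iff)
  ultimately obtain g s where s: "strict_mono s" "(f \<circ> s) \<longlonglongrightarrow> g"
    unfolding seq_compact_def by blast
  have "(\<lambda>j. f (s j) k) \<longlonglongrightarrow> g k" for k
    using continuous_on_tendsto_compose[OF continuous_on_product_coordinates[of k] s(2)] by (simp add: o_def)
  with s show ?thesis using that by blast
qed

lemma LIMSEQ_subsequence_criterion:
  fixes X :: "nat \<Rightarrow> real"
  assumes "\<And>r. strict_mono r \<Longrightarrow> \<exists>s. strict_mono (s :: nat \<Rightarrow> nat) \<and> (\<lambda>j. X (r (s j))) \<longlonglongrightarrow> c"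
  shows "X \<longlonglongrightarrow> c"
proof (rule ccontr)
  assume "\<not> X \<longlonglongrightarrow> c"
  then obtain e where e: "e > 0" "\<And>N. \<exists>n\<ge>N. \<not> norm (X n - c) < e"
    unfolding LIMSEQ_iff by blast
  define S where "S = {n. \<not> norm (X n - c) < e}"
  have "infinite S"
    unfolding infinite_nat_iff_unbounded_le using e(2) by (auto simp: S_def)
  then have r: "strict_mono (enumerate S)" "\<And>k. enumerate S k \<in> S"
    by (auto intro: strict_mono_enumerate enumerate_in_set)
  obtain s :: "nat \<Rightarrow> nat" where "(\<lambda>j. X (enumerate S (s j))) \<longlonglongrightarrow> c" using assms[OF r(1)] by blast
  from LIMSEQ_D[OF this e(1)] obtain n where "norm (X (enumerate S (s n)) - c) < e" by blast
  then show False using r(2)[of "s n"] by (simp add: S_def)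
qed

text \<open>Every subsequence has a further one along which the shifted parameters converge to a
  right limit. The trace formula gives its period average, and \<open>dos_measure\<close> depends on
  the parameters only through the discriminant, so all these limits coincide.\<close>

lemma windowed_moments_tendsto:
  assumes A: "\<And>n. n \<ge> 1 \<Longrightarrow> \<bar>a n\<bar> \<le> A" and B: "\<And>n. n \<ge> 1 \<Longrightarrow> \<bar>b n\<bar> \<le> B"
    and rl: "\<And>ar br. is_right_limit a b ar br \<Longrightarrow> (ar, br) \<in> iso_torus p a0 b0"
  shows "(\<lambda>n. (1 / real p) * (\<Sum>j=1..p. walk (zext a) (zext b) l (int (j + n)) (int (j + n))))
     \<longlonglongrightarrow> (\<integral>x. x ^ l \<partial>dos_measure p a0 b0)"
proof (rule LIMSEQ_subsequence_criterion)
  fix r :: "nat \<Rightarrow> nat" assume r: "strict_mono r"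
  \<comment> \<open>The tag \<open>c\<close> selects \<open>a\<close> or \<open>b\<close>, so one
    subsequence serves both. Negative sites are sent to 0 by \<open>nat\<close>, whence
    \<open>a 0\<close> and \<open>b 0\<close> in the bound.\<close>
  define X where "X j ck = (case ck of (c, k) \<Rightarrow> if c then a (nat (int (r j) + k)) else b (nat (int (r j) + k)))"
    for j :: nat and ck :: "bool \<times> int"
  have "\<bar>X j ck\<bar> \<le> max (max A B) (max \<bar>a 0\<bar> \<bar>b 0\<bar>)" for j ck
  proof (cases ck)
    case (Pair c k)
    show ?thesis using A[of "nat (int (r j) + k)"] B[of "nat (int (r j) + k)"]
      by (cases "nat (int (r j) + k) = 0") (auto simp: X_def Pair le_max_iff_disj)
  qed
  then obtain s g where s: "strict_mono s" "\<And>ck. (\<lambda>j. X (s j) ck) \<longlonglongrightarrow> g ck"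
    using coordinatewise_convergent_subsequence by blast
  define ar where "ar k = g (True, k)" for k
  define br where "br k = g (False, k)" for k
  have la: "(\<lambda>j. a (nat (int (r (s j)) + k))) \<longlonglongrightarrow> ar k" for k
    using s(2)[of "(True, k)"] by (simp add: X_def ar_def)
  have lb: "(\<lambda>j. b (nat (int (r (s j)) + k))) \<longlonglongrightarrow> br k" for k
    using s(2)[of "(False, k)"] by (simp add: X_def br_def)
  have sm: "strict_mono (\<lambda>j. r (s j))" using r s(1) by (simp add: strict_mono_def)
  then have top: "filterlim (\<lambda>j. r (s j)) at_top sequentially" by (rule filterlim_subseq)
  then have "is_right_limit a b ar br"
    unfolding is_right_limit_def using la lb by blast
  then have torus: "periodic_jacobi p ar br" "discriminant ar br p = discriminant a0 b0 p"
    using rl by (auto simp: iso_torus_def)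
  interpret R: periodic p ar br by unfold_locales (rule torus(1))
  have ev: "\<forall>\<^sub>F j in sequentially. 1 \<le> int (r (s j)) + k" for k
  proof -
    have "\<forall>\<^sub>F j in sequentially. nat (1 - k) \<le> r (s j)" using top by (simp add: filterlim_at_top)
    then show ?thesis by eventually_elim auto
  qed
  have za: "(\<lambda>j. zext a (k + int (r (s j)))) \<longlonglongrightarrow> ar k" for k
  proof (rule Lim_transform_eventually[OF la])
    show "\<forall>\<^sub>F j in sequentially. a (nat (int (r (s j)) + k)) = zext a (k + int (r (s j)))"
      using ev[of k] by eventually_elim (auto simp: zext_def add.commute)
  qed
  have zb: "(\<lambda>j. zext b (k + int (r (s j)))) \<longlonglongrightarrow> br k" for k
  proof (rule Lim_transform_eventually[OF lb])
    show "\<forall>\<^sub>F j in sequentially. b (nat (int (r (s j)) + k)) = zext b (k + int (r (s j)))"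
      using ev[of k] by eventually_elim (auto simp: zext_def add.commute)
  qed
  have "(\<lambda>j. walk (zext a) (zext b) l (int (i + r (s j))) (int (i + r (s j)))) \<longlonglongrightarrow> walk ar br l (int i) (int i)" for i
  proof -
    have "(\<lambda>j. walk (\<lambda>k. zext a (k + int (r (s j)))) (\<lambda>k. zext b (k + int (r (s j)))) l (int i) (int i))
      \<longlonglongrightarrow> walk ar br l (int i) (int i)"
      by (rule walk_tendsto) (rule za zb)+
    then show ?thesis unfolding walk_shift[of "zext a" _ "zext b"] by simp
  qed
  then have "(\<lambda>j. (1 / real p) * (\<Sum>i=1..p. walk (zext a) (zext b) l (int (i + r (s j))) (int (i + r (s j)))))
      \<longlonglongrightarrow> (1 / real p) * (\<Sum>i=1..p. walk ar br l (int i) (int i))"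
    by (intro tendsto_mult_left tendsto_sum)
  moreover have "dos_measure p ar br = dos_measure p a0 b0"
    unfolding dos_measure_def periodic_spectrum_def torus(2) ..
  ultimately show "\<exists>s. strict_mono (s :: nat \<Rightarrow> nat) \<and>
      (\<lambda>j. (1 / real p) * (\<Sum>i=1..p. walk (zext a) (zext b) l (int (i + r (s j))) (int (i + r (s j)))))
      \<longlonglongrightarrow> (\<integral>x. x ^ l \<partial>dos_measure p a0 b0)"
    using s(1) unfolding R.trace_formula by auto
qed

section \<open>Both weak limits\<close>

theorem theorem8p1:
  fixes p :: nat and a0 b0 :: "int \<Rightarrow> real"
    and a b :: "nat \<Rightarrow> real" and \<mu> :: "real measure" and P :: "nat \<Rightarrow> real poly"
  assumes J0: "periodic_jacobi p a0 b0"
    and apos: "\<And>n. n \<ge> 1 \<Longrightarrow> a n > 0"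
    and abdd: "bounded (a ` {1..})" and bbdd: "bounded (b ` {1..})"
    and rl: "\<And>ar br. is_right_limit a b ar br \<Longrightarrow> (ar, br) \<in> iso_torus p a0 b0"
    and mu: "is_spectral_measure a b \<mu>"
    and OP: "is_orthonormal_polys \<mu> P"
  shows "(\<forall>f. bounded_continuous_test f \<longrightarrow>
           (\<lambda>n. \<integral>x. f x * ((1 / real p) * (\<Sum>j=1..p. (poly (P (j + n)) x)\<^sup>2)) \<partial>\<mu>)
             \<longlonglongrightarrow> (\<integral>x. f x \<partial>dos_measure p a0 b0))
    \<and> (\<forall>f. bounded_continuous_test f \<longrightarrow>
           (\<lambda>n. (1 / real n) * (\<Sum>x\<in>{x. poly (P n) x = 0}. real (order x (P n)) * f x))
             \<longlonglongrightarrow> (\<integral>x. f x \<partial>dos_measure p a0 b0))"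
proof -
  interpret S: spectral_jacobi a b \<mu> by unfold_locales (use apos mu in auto)
  interpret Z: periodic p a0 b0 by unfold_locales (rule J0)
  obtain A where A: "\<And>n. n \<ge> 1 \<Longrightarrow> \<bar>a n\<bar> \<le> A" using abdd by (auto simp: bounded_iff)
  obtain B where B: "\<And>n. n \<ge> 1 \<Longrightarrow> \<bar>b n\<bar> \<le> B" using bbdd by (auto simp: bounded_iff)
  obtain R where R: "\<And>x. \<bar>poly Z.D x\<bar> \<le> 2 \<Longrightarrow> \<bar>x\<bar> \<le> R" using Z.bd.bounded_spectrum by blast
  \<comment> \<open>One interval for everything: strictly larger than \<open>2 * A + B\<close> as
    \<open>AE_bound\<close> asks, it contains the zeros and, through \<open>R\<close>, the
    spectrum.\<close>
  define C where "C = max (2 * A + B + 1) R"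
  have AB: "A \<ge> 0" "B \<ge> 0" using A[of 1] B[of 1] by auto
  have C: "2 * A + B < C" "C \<ge> 0" "R \<le> C" using AB by (auto simp: C_def)
  have P: "P n = orth a b (Suc n)" for n by (rule S.orthonormal_polys_eq[OF OP])
  define w where "w n x = (1 / real p) * (\<Sum>j=1..p. (poly (P (j + n)) x)\<^sup>2)" for n x
  define Zr where "Zr n = {x. poly (P n) x = 0}" for n
  have Zr: "Zr n = orth_roots a b n" for n by (simp add: Zr_def orth_roots_def P)
  let ?V = "\<lambda>n. (1 / real p) * (\<Sum>j=1..p. walk (zext a) (zext b) l (int (j + n)) (int (j + n)))"
  note avg = windowed_moments_tendsto[OF A B rl]
  have int_sq: "integrable \<mu> (\<lambda>x. x ^ l * (poly q x)\<^sup>2)" for l q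
    by (rule Bochner_Integration.integrable_cong[THEN iffD1, OF refl _ S.integrable_poly[of "monom 1 l * (q * q)"]])
       (simp add: poly_monom power2_eq_square)
  \<comment> \<open>\<open>P n\<close> is \<open>orth a b (Suc n)\<close>, so the diagonal window is
    shifted by one; \<open>LIMSEQ_Suc\<close> absorbs this in the limit.\<close>
  have mom_w: "(\<integral>x. x ^ l * w n x \<partial>\<mu>)
      = (1 / real p) * (\<Sum>j=1..p. walk (zext a) (zext b) l (int (j + Suc n)) (int (j + Suc n)))" for l n
  proof -
    have "x ^ l * w n x = (1 / real p) * (\<Sum>j=1..p. x ^ l * (poly (P (j + n)) x)\<^sup>2)" for x
      unfolding w_def sum_distrib_left by (simp only: mult.left_commute)
    then have "(\<integral>x. x ^ l * w n x \<partial>\<mu>) = (1 / real p) * (\<Sum>j=1..p. \<integral>x. x ^ l * (poly (P (j + n)) x)\<^sup>2 \<partial>\<mu>)"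
      using int_sq by (simp add: Bochner_Integration.integral_sum)
    also have "\<dots> = (1 / real p) * (\<Sum>j=1..p. walk (zext a) (zext b) l (int (j + Suc n)) (int (j + Suc n)))"
      unfolding P using S.integral_moment by simp
    finally show ?thesis .
  qed
  have w_int: "integrable \<mu> (w n)" for n
    unfolding w_def using int_sq[of 0]
    by (intro integrable_mult_right Bochner_Integration.integrable_sum) simp
  have w_one: "(\<integral>x. w n x \<partial>\<mu>) = 1" for n
    using mom_w[of 0 n] Z.p_pos by simp
  have La: "sup_bounded_functional C 1 (\<lambda>f. \<integral>x. f x * w n x \<partial>\<mu>)" for n
  proof -
    have "sup_bounded_functional C (\<integral>x. w n x \<partial>\<mu>) (\<lambda>f. \<integral>x. f x * w n x \<partial>\<mu>)"
      by (intro sup_bounded_functional_integral S.sets_mu w_int S.AE_bound[OF A B C(1)])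
         (simp add: w_def sum_nonneg)
    then show ?thesis unfolding w_one .
  qed
  have Lb: "sup_bounded_functional C 1 (\<lambda>f. (1 / real n) * (\<Sum>x\<in>Zr n. f x))" for n
  proof (rule sup_bounded_functional_average)
    show "card (Zr n) \<le> n" unfolding Zr S.card_orth_roots ..
    show "\<bar>x\<bar> \<le> C" if "x \<in> Zr n" for x
      using S.orth_roots_bound[OF that[unfolded Zr] A B] C by simp
  qed (rule C)
  have dos1: "integrable (dos_measure p a0 b0) (\<lambda>x. 1 :: real)"
    unfolding Z.dos_measure_eq by (rule Z.bd.dos_integral(1)) simp
  have "AE x in dos_measure p a0 b0. \<bar>x\<bar> \<le> C"
    unfolding Z.dos_measure_eq using Z.bd.AE_dos by eventually_elim (use R C in force)
  then have L': "sup_bounded_functional C (\<integral>x. (1::real) \<partial>dos_measure p a0 b0) (\<lambda>f. \<integral>x. f x \<partial>dos_measure p a0 b0)"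
    using sup_bounded_functional_integral[of "dos_measure p a0 b0" "\<lambda>_. 1 :: real" C] dos1
    by (simp add: dos_measure_def)
  have M': "0 \<le> (\<integral>x. (1::real) \<partial>dos_measure p a0 b0)" by simp
  have "(\<lambda>n. \<integral>x. f x * w n x \<partial>\<mu>) \<longlonglongrightarrow> (\<integral>x. f x \<partial>dos_measure p a0 b0)"
    if "bounded_continuous_test f" for f
  proof (rule moments_imp_weak[OF La L' _ M'])
    show "(\<lambda>n. \<integral>x. x ^ l * w n x \<partial>\<mu>) \<longlonglongrightarrow> (\<integral>x. x ^ l \<partial>dos_measure p a0 b0)" for l
      unfolding mom_w by (rule LIMSEQ_Suc[OF avg])
  qed (use that in \<open>auto simp: bounded_continuous_test_def\<close>)
  moreover have "(\<lambda>n. (1 / real n) * (\<Sum>x\<in>Zr n. f x)) \<longlonglongrightarrow> (\<integral>x. f x \<partial>dos_measure p a0 b0)"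
    if "bounded_continuous_test f" for f
  proof (rule moments_imp_weak[OF Lb L' _ M'])
    show "(\<lambda>n. (1 / real n) * (\<Sum>x\<in>Zr n. x ^ l)) \<longlonglongrightarrow> (\<integral>x. x ^ l \<partial>dos_measure p a0 b0)" for l
      unfolding Zr by (rule S.root_moments_tendsto[OF A B Z.p_pos avg])
  qed (use that in \<open>auto simp: bounded_continuous_test_def\<close>)
  \<comment> \<open>Simplicity of the zeros makes every \<open>order\<close> equal to one.\<close>
  moreover have "(\<Sum>x\<in>Zr n. real (order x (P n)) * f x) = (\<Sum>x\<in>Zr n. f x)" for n and f :: "real \<Rightarrow> real"
  proof (intro sum.cong refl)
    fix x assume "x \<in> Zr n"
    then have x: "poly (P n) x = 0" by (simp add: Zr_def)
    then have "poly (pderiv (P n)) x \<noteq> 0" unfolding P by (rule S.u_roots_simple)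
    then have "order x (pderiv (P n)) = 0" by (rule order_0I)
    then have "order x (P n) = 1" using order_pderiv[of "P n" x] x by (simp add: P)
    then show "real (order x (P n)) * f x = f x" by simp
  qed
  ultimately show ?thesis unfolding w_def Zr_def by simp
qed

end
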